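(* Let $K/\mathbf{k}$ be a finitely generated extension of fields of characteristic zero. (a) There exists an affine $\mathbf{k}$-domain $B$, with $K\subseteq \operatorname{Frac} B$ as an extension of $\mathbf{k}$, satisfying $\operatorname{Frac} B = K^{(2)}$, $\operatorname{ML}(B)=\mathbf{k}$ and $K\in\mathcal{K}(B)$. (b) There exists a normal affine $\mathbf{k}$-domain $B$, with $K\subseteq \operatorname{Frac} B$ as an extension of $\mathbf{k}$, satisfying $\operatorname{Frac} B = K^{(2)}$, $\operatorname{ML}(B)=\mathbf{k}'$ and $K\in\mathcal{K}(B)$, where $\mathbf{k}'$ is the algebraic closure of $\mathbf{k}$ in $K$.
   Context: All rings are commutative with unity; "domain" means integral domain. For a field $\mathbf{k}$, a $\mathbf{k}$-domain is a domain that is a $\mathbf{k}$-algebra, and it is affine if it is finitely generated as a $\mathbf{k}$-algebra. For a field $K$, $L=K^{(n)}$ means that $L$ is a purely transcendental extension of $K$ of transcendence degree $n$ (the field of fractions of a polynomial ring in $n$ variables over $K$). A derivation $D:B\to B$ is locally nilpotent if for each $x\in B$ there is $n\in\mathbb{N}$ with $D^n(x)=0$; $\operatorname{LND}(B)$ is the set of locally nilpotent derivations $B\to B$. $\operatorname{ML}(B)=\bigcap_{D\in\operatorname{LND}(B)}\ker D$. For a domain $B$ of characteristic zero and $\Delta\subseteq\operatorname{LND}(B)$, put $K_\Delta=\bigcap_{D\in\Delta}\operatorname{Frac}(\ker D)$ (intersection in $\operatorname{Frac} B$, with $K_\emptyset=\operatorname{Frac} B$), and $\mathcal{K}(B)=\{K_\Delta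 : \Delta\subseteq\operatorname{LND}(B)\}$. *)

theory Defs
  imports
    "HOL-Library.FuncSet"
    "HOL-Computational_Algebra.Polynomial"
    "HOL-Computational_Algebra.Fraction_Field"
begin

text \<open>
  Domains and fields are treated as subsets of an ambient field, given by a type of class
  \<^class>\<open>field\<close>. A subring of a field is automatically a domain.
\<close>

definition is_subring :: "'a::comm_ring_1 set \<Rightarrow> bool" where
  "is_subring A \<longleftrightarrow> 1 \<in> A \<and> (\<forall>x\<in>A. \<forall>y\<in>A. x - y \<in> A \<and> x * y \<in> A)"

definition is_subfield :: "'a::field set \<Rightarrow> bool" where
  "is_subfield F \<longleftrightarrow> is_subring F \<and> (\<forall>x\<in>F. inverse x \<in> F)"

definition fg_field_extension :: "'a::field set \<Rightarrow> 'a set \<Rightarrow> bool" where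
  "fg_field_extension k F \<longleftrightarrow>
     is_subfield k \<and> is_subfield F \<and> (\<exists>S. finite S \<and> F = is_subfield hull (k \<union> S))"

text \<open>
  Since \<open>is_subring hull (k \<union> S)\<close> is the \<open>k\<close>-subalgebra generated by \<open>S\<close>, the following says
  that \<open>B\<close> contains \<open>k\<close> and is finitely generated as a \<open>k\<close>-algebra.
\<close>

definition affine_domain :: "'a::field set \<Rightarrow> 'a set \<Rightarrow> bool" where
  "affine_domain k B \<longleftrightarrow>
     is_subring B \<and> k \<subseteq> B \<and> (\<exists>S. finite S \<and> B = is_subring hull (k \<union> S))"

definition Frac :: "'a::field set \<Rightarrow> 'a set" where
  "Frac A = {x / y |x y. x \<in> A \<and> y \<in> A \<and> y \<noteq> 0}"

definition normal_domain :: "'a::field set \<Rightarrow> bool" where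
  "normal_domain B \<longleftrightarrow>
     is_subring B \<and>
     (\<forall>x\<in>Frac B. (\<exists>p. lead_coeff p = 1 \<and> (\<forall>i. coeff p i \<in> B) \<and> poly p x = 0) \<longrightarrow> x \<in> B)"

definition algebraic_closure_in :: "'a::field set \<Rightarrow> 'a set \<Rightarrow> 'a set" where
  "algebraic_closure_in k F = {x \<in> F. \<exists>p. p \<noteq> 0 \<and> (\<forall>i. coeff p i \<in> k) \<and> poly p x = 0}"

text \<open>
  A map \<open>B \<rightarrow> B\<close> is a function on the ambient field that is \<open>undefined\<close> outside \<open>B\<close>, so that
  maps \<open>B \<rightarrow> B\<close> are equal iff they agree on \<open>B\<close>.
\<close>

definition derivation_on :: "'a::field set \<Rightarrow> ('a \<Rightarrow> 'a) \<Rightarrow> bool" where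
  "derivation_on B D \<longleftrightarrow>
     D \<in> B \<rightarrow>\<^sub>E B \<and>
     (\<forall>x\<in>B. \<forall>y\<in>B. D (x + y) = D x + D y \<and> D (x * y) = D x * y + x * D y)"

definition LND :: "'a::field set \<Rightarrow> ('a \<Rightarrow> 'a) set" where
  "LND B = {D. derivation_on B D \<and> (\<forall>x\<in>B. \<exists>n::nat. (D ^^ n) x = 0)}"

definition ker_on :: "'a::field set \<Rightarrow> ('a \<Rightarrow> 'a) \<Rightarrow> 'a set" where
  "ker_on B D = {x \<in> B. D x = 0}"

definition Makar_Limanov :: "'a::field set \<Rightarrow> 'a set" where
  "Makar_Limanov B = (\<Inter>D\<in>LND B. ker_on B D)"

text \<open>The intersection with \<open>Frac B\<close> implements the convention for the empty family.\<close>

definition K_Delta :: "'a::field set \<Rightarrow> ('a \<Rightarrow> 'a) set \<Rightarrow> 'a set" where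
  "K_Delta B \<Delta> = Frac B \<inter> (\<Inter>D\<in>\<Delta>. Frac (ker_on B D))"

definition K_family :: "'a::field set \<Rightarrow> 'a set set" where
  "K_family B = {K_Delta B \<Delta> |\<Delta>. \<Delta> \<subseteq> LND B}"

text \<open>
  For a field type \<open>'a\<close>, the type \<open>'a ratfun2\<close> is the field of fractions of the polynomial ring
  \<open>'a[X][Y]\<close> in two variables; \<open>ratfun2_const\<close> embeds \<open>'a\<close> into it as the constants.
\<close>

type_synonym 'a ratfun2 = "'a poly poly fract"

definition ratfun2_const :: "'a::field \<Rightarrow> 'a ratfun2" where
  "ratfun2_const c = Fract [:[:c:]:] 1"

end

theory Submission
  imports
    "HOL-Algebra.Algebraic_Closure_Type"
    "Jordan_Normal_Form.Char_Poly"
    Defs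
begin

text \<open>
  Let \<open>R = \<Oplus>\<^sub>m R\<^sub>m T\<^sup>m\<close> be a graded subring of \<open>K[T]\<close>, finitely generated over \<open>k\<close>, that contains \<open>T\<close>
  and whose homogeneous fractions of degree zero fill \<open>K\<close>. The ring in question is
  \<open>B = \<Oplus>\<^sub>i\<^sub>,\<^sub>j R\<^sub>i\<^sub>+\<^sub>j x\<^sup>i y\<^sup>j\<close>, a subring of \<open>K[x, y]\<close>. The total degree is
  unchanged by \<open>D\<^sub>1 = y \<partial>/\<partial>x\<close> and \<open>D\<^sub>2 = x \<partial>/\<partial>y\<close>, so that both are locally nilpotent derivations of
  \<open>B\<close>. Their kernels are \<open>B \<inter> K[y]\<close> and \<open>B \<inter> K[x]\<close>, and the fraction fields of these both contain
  \<open>K\<close>. A fraction of polynomials in \<open>y\<close> that is a fraction of polynomials in \<open>x\<close> is constant; hence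
  \<open>K = K\<^sub>\<Delta>\<close> for \<open>\<Delta> = {D\<^sub>1, D\<^sub>2}\<close>. In the same way the Makar-Limanov invariant is contained in
  \<open>B \<inter> K = R\<^sub>0\<close>, and equality holds as soon as \<open>R\<^sub>0\<close> is a field, because locally nilpotent derivations
  annihilate units. All this is in the locale \<open>graded_coordinate_ring\<close>; it reduces the theorem to
  the choice of \<open>R\<close>.

  For the first part let \<open>K\<close> be generated by \<open>s\<^sub>1, \<dots>, s\<^sub>n\<close> over \<open>k\<close> and take
  \<open>R = k[T, s\<^sub>1 T, \<dots>, s\<^sub>n T]\<close>, for which \<open>R\<^sub>0 = k\<close>.

  For the second part \<open>R\<close> should be normal. Then \<open>B = R[y/x] \<inter> K[x, y]\<close> is an intersection of two
  polynomial rings over normal domains and hence normal, and \<open>R\<^sub>0\<close> is the algebraic closure of \<open>k\<close>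
  in \<open>K\<close> provided that the constant terms of elements of \<open>R\<close> are algebraic over \<open>k\<close>. A normal \<open>R\<close>
  is built from \<open>k[T]\<close> by treating one generator \<open>s\<close> of \<open>K\<close> at a time. If \<open>s T\<close> is
  transcendental over the fraction field of the ring \<open>R\<close> reached so far, \<open>R[s T]\<close> is a
  polynomial ring and so stays normal. Otherwise \<open>R\<close> is replaced by its integral closure in the fraction
  field of \<open>R[s T]\<close>, a simple algebraic extension of the fraction field of \<open>R\<close>. This closure is again
  finitely generated (\<open>affine_normal_integral_closure\<close>): by interpolation at the conjugates of a primitive element \<open>z\<close>
  it has a common denominator with respect to \<open>R[z]\<close>, and \<open>R[z]\<close> is Noetherian. Both
  steps preserve stability under \<open>T \<mapsto> n T\<close> for positive integers \<open>n\<close>, and this makes \<open>R\<close> graded: the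
  homogeneous components of \<open>r\<close> are the coefficients of \<open>r(n T)\<close>, read as a polynomial in \<open>n\<close>, and
  can be recovered from its values.

  Two facts are used throughout: an element is integral as soon as it maps a finitely
  generated module containing \<open>1\<close> to itself, and a polynomial whose values at positive integers lie in a group \<open>M\<close>
  closed under division by positive integers has all its coefficients in \<open>M\<close>.
\<close>

section \<open>Subrings and integral elements\<close>

lemma subring_one: "is_subring A \<Longrightarrow> 1 \<in> A"
  and subring_diff: "is_subring A \<Longrightarrow> x \<in> A \<Longrightarrow> y \<in> A \<Longrightarrow> x - y \<in> A"
  and subring_mult: "is_subring A \<Longrightarrow> x \<in> A \<Longrightarrow> y \<in> A \<Longrightarrow> x * y \<in> A"
  by (auto simp: is_subring_def)

lemma subring_zero: "is_subring A \<Longrightarrow> 0 \<in> A"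
  using subring_diff[of A 1 1] subring_one[of A] by simp

lemma subring_uminus: "is_subring A \<Longrightarrow> x \<in> A \<Longrightarrow> - x \<in> A"
  using subring_diff[of A 0 x] subring_zero[of A] by simp

lemma subring_add: "is_subring A \<Longrightarrow> x \<in> A \<Longrightarrow> y \<in> A \<Longrightarrow> x + y \<in> A"
  using subring_diff[of A x "- y"] subring_uminus[of A y] by simp

lemma subring_sum: "is_subring A \<Longrightarrow> (\<And>i. i \<in> I \<Longrightarrow> f i \<in> A) \<Longrightarrow> sum f I \<in> A"
  by (induction I rule: infinite_finite_induct) (auto simp: subring_zero subring_add)

lemma subring_prod: "is_subring A \<Longrightarrow> (\<And>i. i \<in> I \<Longrightarrow> f i \<in> A) \<Longrightarrow> prod f I \<in> A"
  by (induction I rule: infinite_finite_induct) (auto simp: subring_one subring_mult)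

lemma subring_power: "is_subring A \<Longrightarrow> x \<in> A \<Longrightarrow> x ^ n \<in> A"
  by (induction n) (auto simp: subring_one subring_mult)

lemma subring_of_nat: "is_subring A \<Longrightarrow> of_nat n \<in> A"
  by (induction n) (auto simp: subring_zero subring_one subring_add)

lemmas subring_intros = subring_zero subring_one subring_diff subring_mult subring_uminus
  subring_add subring_sum subring_prod subring_power subring_of_nat

lemma is_subring_hull: "is_subring (is_subring hull S)"
  by (rule hull_in) (auto simp: is_subring_def)

definition polys_over :: "'a::zero set \<Rightarrow> 'a poly set" where
  "polys_over A = {p. \<forall>i. coeff p i \<in> A}"

lemma polys_overI: "(\<And>i. coeff p i \<in> A) \<Longrightarrow> p \<in> polys_over A"
  and polys_overD: "p \<in> polys_over A \<Longrightarrow> coeff p i \<in> A"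
  by (auto simp: polys_over_def)

lemma polys_over_mono: "A \<subseteq> B \<Longrightarrow> p \<in> polys_over A \<Longrightarrow> p \<in> polys_over B"
  by (auto simp: polys_over_def)

lemma is_subring_polys_over:
  assumes A: "is_subring A"
  shows "is_subring (polys_over A)"
  unfolding is_subring_def[of "polys_over A"]
proof (intro conjI ballI)
  show "1 \<in> polys_over A"
    by (rule polys_overI) (simp add: coeff_1 subring_zero[OF A] subring_one[OF A])
  fix p q assume "p \<in> polys_over A" "q \<in> polys_over A"
  then have pq: "\<And>i. coeff p i \<in> A" "\<And>i. coeff q i \<in> A" by (auto simp: polys_over_def)
  show "p - q \<in> polys_over A" "p * q \<in> polys_over A"
    using pq by (auto intro!: polys_overI subring_sum[OF A] subring_diff[OF A] subring_mult[OF A]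
        simp: coeff_mult)
qed

lemma polys_over_const: "is_subring A \<Longrightarrow> c \<in> A \<Longrightarrow> [:c:] \<in> polys_over A"
  by (auto simp: polys_over_def coeff_pCons subring_zero split: nat.split)

lemma polys_over_monom: "is_subring A \<Longrightarrow> c \<in> A \<Longrightarrow> monom c n \<in> polys_over A"
  by (auto simp: polys_over_def subring_zero)

lemma polys_over_X: "is_subring A \<Longrightarrow> [:0, 1:] \<in> polys_over A"
  by (auto simp: polys_over_def coeff_pCons coeff_1 subring_zero subring_one split: nat.split)

lemma polys_over_linear: "is_subring A \<Longrightarrow> c \<in> A \<Longrightarrow> pCons c 1 \<in> polys_over A"
  by (auto simp: polys_over_def coeff_pCons coeff_1 subring_zero subring_one split: nat.split)

lemma poly_mem_subring:
  assumes "is_subring A" "p \<in> polys_over A" "x \<in> A"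
  shows "poly p x \<in> A"
  unfolding poly_altdef using assms by (auto intro!: subring_intros dest: polys_overD)

definition integral_over :: "'a::comm_ring_1 set \<Rightarrow> 'a \<Rightarrow> bool" where
  "integral_over A x \<longleftrightarrow> (\<exists>p\<in>polys_over A. lead_coeff p = 1 \<and> poly p x = 0)"

lemma integral_over_mono: "A \<subseteq> B \<Longrightarrow> integral_over A x \<Longrightarrow> integral_over B x"
  unfolding integral_over_def using polys_over_mono by blast

lemma integral_over_self: "is_subring A \<Longrightarrow> x \<in> A \<Longrightarrow> integral_over A x"
  unfolding integral_over_def
  by (rule bexI[where x = "[:- x, 1:]"])
    (auto simp: polys_over_def coeff_pCons subring_intros split: nat.split)

definition is_submodule :: "'a::comm_ring_1 set \<Rightarrow> 'a set \<Rightarrow> bool" where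
  "is_submodule A N \<longleftrightarrow>
     0 \<in> N \<and> (\<forall>x\<in>N. \<forall>y\<in>N. x + y \<in> N) \<and> (\<forall>a\<in>A. \<forall>x\<in>N. a * x \<in> N)"

lemma submodule_add: "is_submodule A N \<Longrightarrow> x \<in> N \<Longrightarrow> y \<in> N \<Longrightarrow> x + y \<in> N"
  and submodule_smult: "is_submodule A N \<Longrightarrow> a \<in> A \<Longrightarrow> x \<in> N \<Longrightarrow> a * x \<in> N"
  by (auto simp: is_submodule_def)

lemma submodule_sum: "is_submodule A N \<Longrightarrow> (\<And>i. i \<in> I \<Longrightarrow> f i \<in> N) \<Longrightarrow> sum f I \<in> N"
  by (induction I rule: infinite_finite_induct) (auto simp: is_submodule_def)

lemma submodule_uminus: "is_submodule A N \<Longrightarrow> is_subring A \<Longrightarrow> x \<in> N \<Longrightarrow> - x \<in> N"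
  using subring_uminus[of A 1] subring_one[of A] by (force simp: is_submodule_def)

lemma submodule_diff:
  "is_submodule A N \<Longrightarrow> is_subring A \<Longrightarrow> x \<in> N \<Longrightarrow> y \<in> N \<Longrightarrow> x - y \<in> N"
  using submodule_uminus[of A N y] by (metis add_uminus_conv_diff is_submodule_def)

definition lspan :: "'a::comm_ring_1 set \<Rightarrow> 'a set \<Rightarrow> 'a set" where
  "lspan A M = {\<Sum>m\<in>M. a m * m |a. \<forall>m. a m \<in> A}"

lemma is_submodule_lspan:
  assumes "is_subring A"
  shows "is_submodule A (lspan A M)"
proof -
  have "0 \<in> lspan A M"
    unfolding lspan_def using assms
    by (intro CollectI exI[of _ "\<lambda>_. 0"]) (auto simp: subring_zero)
  moreover have "x + y \<in> lspan A M" if xy: "x \<in> lspan A M" "y \<in> lspan A M" for x y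
  proof -
    obtain a b where "x = (\<Sum>m\<in>M. a m * m)" "y = (\<Sum>m\<in>M. b m * m)" "\<forall>m. a m \<in> A" "\<forall>m. b m \<in> A"
      using xy unfolding lspan_def by blast
    then show ?thesis
      unfolding lspan_def using assms
      by (intro CollectI exI[of _ "\<lambda>m. a m + b m"])
        (auto simp: sum.distrib distrib_right subring_add)
  qed
  moreover have "c * x \<in> lspan A M" if cx: "c \<in> A" "x \<in> lspan A M" for c x
  proof -
    obtain a where "x = (\<Sum>m\<in>M. a m * m)" "\<forall>m. a m \<in> A"
      using cx unfolding lspan_def by blast
    then show ?thesis
      unfolding lspan_def using assms cx
      by (intro CollectI exI[of _ "\<lambda>m. c * a m"])
        (auto simp: sum_distrib_left mult.assoc subring_mult)
  qed
  ultimately show ?thesis by (auto simp: is_submodule_def)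
qed

lemma lspan_inc:
  assumes "is_subring A" "finite M" "m \<in> M"
  shows "m \<in> lspan A M"
proof -
  have "(\<Sum>m'\<in>M. (if m' = m then 1 else 0) * m') = (\<Sum>m'\<in>M. if m' = m then m' else 0)"
    by (rule sum.cong) auto
  also have "\<dots> = m" using assms by simp
  finally have "(\<Sum>m'\<in>M. (if m' = m then 1 else 0) * m') = m" .
  then show ?thesis
    unfolding lspan_def using assms
    by (intro CollectI exI[of _ "\<lambda>m'. if m' = m then 1 else 0"]) (auto simp: subring_intros)
qed

lemma lspan_minimal:
  assumes "is_submodule A N" "M \<subseteq> N"
  shows "lspan A M \<subseteq> N"
  using assms unfolding lspan_def by (auto intro!: submodule_sum[of A] simp: is_submodule_def subset_eq)

text \<open>
  The determinant trick: multiplication by \<open>x\<close> on the generators is given by a square matrix with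
  entries in \<open>A\<close>, of which \<open>x\<close> is an eigenvalue. The characteristic polynomial is monic with
  coefficients in \<open>A\<close>.
\<close>

lemma integral_over_if_stable_lspan:
  fixes A :: "'a::field set"
  assumes A: "is_subring A" and fin: "finite M" and m0: "m0 \<in> M" "m0 \<noteq> 0"
    and stable: "\<And>m. m \<in> M \<Longrightarrow> x * m \<in> lspan A M"
  shows "integral_over A x"
proof -
  define n where "n = card M"
  obtain e where e: "bij_betw e {0..<n} M"
    using ex_bij_betw_nat_finite[OF fin] unfolding n_def by blast
  have "\<exists>a. (\<forall>m'. a m' \<in> A) \<and> x * m = (\<Sum>m'\<in>M. a m' * m')" if "m \<in> M" for m
    using stable[OF that] unfolding lspan_def by blast
  then obtain c where c: "\<And>m m'. m \<in> M \<Longrightarrow> c m m' \<in> A"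
    "\<And>m. m \<in> M \<Longrightarrow> x * m = (\<Sum>m'\<in>M. c m m' * m')"
    by metis
  define C where "C = mat n n (\<lambda>(i,j). c (e i) (e j))"
  define v where "v = vec n e"
  have C: "C \<in> carrier_mat n n" by (simp add: C_def)
  have eM: "e i \<in> M" if "i < n" for i using e that by (auto simp: bij_betw_def)
  have "C *\<^sub>v v = x \<cdot>\<^sub>v v"
  proof (rule eq_vecI)
    fix i assume "i < dim_vec (x \<cdot>\<^sub>v v)"
    then have i: "i < n" by (simp add: v_def)
    have "(C *\<^sub>v v) $ i = (\<Sum>j\<in>{0..<n}. c (e i) (e j) * e j)"
      using i by (simp add: C_def v_def scalar_prod_def)
    also have "\<dots> = (\<Sum>m'\<in>M. c (e i) m' * m')"
      by (rule sum.reindex_bij_betw[OF e])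
    also have "\<dots> = x * e i" using c(2)[OF eM[OF i]] by simp
    finally show "(C *\<^sub>v v) $ i = (x \<cdot>\<^sub>v v) $ i" using i by (simp add: v_def)
  qed (simp add: C_def v_def)
  moreover have "v \<noteq> 0\<^sub>v n"
  proof
    assume v0: "v = 0\<^sub>v n"
    obtain i where "i < n" "e i = m0" using e m0 by (auto simp: bij_betw_def)
    with v0 m0 show False unfolding v_def by (metis index_vec index_zero_vec(1))
  qed
  ultimately have "eigenvalue C x"
    unfolding eigenvalue_def eigenvector_def using C by (intro exI[of _ v]) (auto simp: v_def)
  then have root: "poly (char_poly C) x = 0"
    using eigenvalue_root_char_poly[OF C] by simp
  have PA: "is_subring (polys_over A)" by (rule is_subring_polys_over[OF A])
  have "char_poly C \<in> polys_over A"
    unfolding char_poly_def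
    by (subst det_def'[OF char_poly_matrix_closed[OF C]], intro subring_intros PA)
      (use C A c eM in \<open>auto simp: sign_def char_poly_matrix_def permutes_in_image C_def
         intro!: subring_intros PA polys_over_const polys_over_X polys_over_linear\<close>)
  then show ?thesis
    unfolding integral_over_def using root degree_monic_char_poly[OF C] by auto
qed

definition multipliers :: "'a::comm_ring_1 set \<Rightarrow> 'a set" where
  "multipliers N = {v. \<forall>x\<in>N. v * x \<in> N}"

lemma is_subring_multipliers:
  assumes "is_submodule A N" "is_subring A"
  shows "is_subring (multipliers N)"
  unfolding is_subring_def multipliers_def
  using submodule_diff[OF assms] by (auto simp: left_diff_distrib mult.assoc)

lemma integral_over_multipliers:
  fixes A :: "'a::field set"
  assumes A: "is_subring A" and fin: "finite M" and one: "1 \<in> lspan A M"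
    and x: "x \<in> multipliers (lspan A M)"
  shows "integral_over A x"
proof -
  obtain m0 where m0: "m0 \<in> M" "m0 \<noteq> 0"
  proof (rule ccontr)
    assume *: "\<not> thesis"
    have "lspan A M \<subseteq> {0}"
      by (rule lspan_minimal[of A]) (use * that in \<open>auto simp: is_submodule_def\<close>)
    then show False using one by auto
  qed
  show ?thesis
    by (rule integral_over_if_stable_lspan[OF A fin m0])
      (use x lspan_inc[OF A fin] in \<open>auto simp: multipliers_def\<close>)
qed

text \<open>
  If the coefficients of an integral equation of degree \<open>d\<close> for \<open>y\<close> act on a finitely generated
  module \<open>N\<close>, then \<open>N + N y + \<dots> + N y\<^bsup>d-1\<^esup>\<close> is finitely generated, and \<open>y\<close> acts on it as well.
  Iterating this collects any finite set of integral elements in the ring of multipliers of one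
  module, whence closure under ring operations and transitivity of integrality.
\<close>

lemma extend_multipliers:
  fixes A :: "'a::field set"
  assumes A: "is_subring A" and fin: "finite M" and one: "1 \<in> lspan A M"
    and y: "integral_over (multipliers (lspan A M)) y"
  obtains M' where "finite M'" "1 \<in> lspan A M'"
    "insert y (multipliers (lspan A M)) \<subseteq> multipliers (lspan A M')"
proof -
  define N where "N = lspan A M"
  obtain p where p: "p \<in> polys_over (multipliers N)" "lead_coeff p = 1" "poly p y = 0"
    using y unfolding integral_over_def N_def by blast
  define d where "d = degree p"
  have d: "0 < d"
  proof (rule ccontr)
    assume "\<not> 0 < d"
    then obtain c where "p = [:c:]" unfolding d_def by (metis degree_eq_zeroE neq0_conv)
    with p show False by simp
  qed
  define M' where "M' = (\<lambda>(m,i). m * y ^ i) ` (M \<times> {..<d})"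
  define N' where "N' = lspan A M'"
  have fin': "finite M'" unfolding M'_def using fin by auto
  have smN: "is_submodule A N" and smN': "is_submodule A N'"
    unfolding N_def N'_def by (rule is_submodule_lspan[OF A])+
  have M'inc: "m * y ^ i \<in> N'" if "m \<in> M" "i < d" for m i
    unfolding N'_def by (rule lspan_inc[OF A fin']) (use that in \<open>auto simp: M'_def\<close>)
  have Ny: "n * y ^ i \<in> N'" if n: "n \<in> N" and i: "i < d" for n i
  proof -
    have "N \<subseteq> {n. n * y ^ i \<in> N'}"
      unfolding N_def
      by (rule lspan_minimal)
        (use smN' M'inc i in \<open>auto simp: is_submodule_def distrib_right mult.assoc\<close>)
    then show ?thesis using n by auto
  qed
  have 1: "1 \<in> N'" using Ny[of 1 0] one d by (simp add: N_def)
  have in_mult: "v \<in> multipliers N'"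
    if *: "\<And>m i. m \<in> M \<Longrightarrow> i < d \<Longrightarrow> v * (m * y ^ i) \<in> N'" for v
  proof -
    have "is_submodule A {n. v * n \<in> N'}"
      using smN' by (auto simp: is_submodule_def distrib_left mult.left_commute)
    moreover have "M' \<subseteq> {n. v * n \<in> N'}" using * by (auto simp: M'_def)
    ultimately have "N' \<subseteq> {n. v * n \<in> N'}"
      unfolding N'_def by (rule lspan_minimal)
    then show ?thesis by (auto simp: multipliers_def)
  qed
  have MN: "m \<in> N" if "m \<in> M" for m
    unfolding N_def by (rule lspan_inc[OF A fin that])
  have "multipliers N \<subseteq> multipliers N'"
  proof
    fix v assume v: "v \<in> multipliers N"
    show "v \<in> multipliers N'"
    proof (rule in_mult)
      fix m i assume "m \<in> M" "i < d"
      then show "v * (m * y ^ i) \<in> N'"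
        using Ny[of "v * m" i] v MN by (auto simp: multipliers_def mult.assoc)
    qed
  qed
  moreover have "y \<in> multipliers N'"
  proof (rule in_mult)
    fix m i assume m: "m \<in> M" and i: "i < d"
    show "y * (m * y ^ i) \<in> N'"
    proof (cases "Suc i < d")
      case True
      then show ?thesis using M'inc[OF m True] by (simp add: ac_simps)
    next
      case False
      with i have di: "d = Suc i" by simp
      have "(\<Sum>j\<le>d. coeff p j * y ^ j) = 0" using p(3) by (simp add: poly_altdef d_def)
      then have "(\<Sum>j<d. coeff p j * y ^ j) + y ^ d = 0"
        using p(2) by (simp add: lessThan_Suc_atMost[symmetric] d_def)
      then have "y ^ d = - (\<Sum>j<d. coeff p j * y ^ j)" by (simp add: eq_neg_iff_add_eq_0 add.commute)
      then have "y * (m * y ^ i) = - (\<Sum>j<d. coeff p j * y ^ j) * m"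
        by (simp add: di ac_simps)
      also have "\<dots> = - (\<Sum>j<d. (coeff p j * m) * y ^ j)"
        by (simp add: sum_distrib_left sum_distrib_right ac_simps)
      finally have eq: "y * (m * y ^ i) = - (\<Sum>j<d. (coeff p j * m) * y ^ j)" .
      have "(coeff p j * m) * y ^ j \<in> N'" if "j < d" for j
        by (rule Ny) (use that p(1) MN[OF m] in \<open>auto simp: polys_over_def multipliers_def\<close>)
      then show ?thesis
        unfolding eq by (intro submodule_uminus[OF smN' A] submodule_sum[OF smN']) auto
    qed
  qed
  ultimately show thesis
    using that[of M'] fin' 1 by (auto simp: N_def N'_def)
qed

lemma finite_integral_multipliers:
  fixes A :: "'a::field set"
  assumes A: "is_subring A" and "finite U" "\<And>x. x \<in> U \<Longrightarrow> integral_over A x"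
  shows "\<exists>M. finite M \<and> 1 \<in> lspan A M \<and> U \<subseteq> multipliers (lspan A M)"
  using assms(2,3)
proof (induction U rule: finite_induct)
  case empty
  show ?case using lspan_inc[OF A, of "{1}"] by (intro exI[of _ "{1}"]) auto
next
  case (insert y U)
  then obtain M where M: "finite M" "1 \<in> lspan A M" "U \<subseteq> multipliers (lspan A M)" by auto
  have "A \<subseteq> multipliers (lspan A M)"
    using is_submodule_lspan[OF A, of M] by (auto simp: is_submodule_def multipliers_def)
  then have "integral_over (multipliers (lspan A M)) y"
    using insert.prems integral_over_mono by blast
  from extend_multipliers[OF A M(1,2) this] M(3) show ?case by (metis insert_subset order_trans)
qed

lemma is_subring_integral_closure:
  fixes A :: "'a::field set"
  assumes A: "is_subring A"
  shows "is_subring {x. integral_over A x}"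
proof -
  have "integral_over A (x - y) \<and> integral_over A (x * y)"
    if xy: "integral_over A x" "integral_over A y" for x y
  proof -
    obtain M where M: "finite M" "1 \<in> lspan A M" "{x, y} \<subseteq> multipliers (lspan A M)"
      using finite_integral_multipliers[OF A, of "{x, y}"] xy by auto
    have "is_subring (multipliers (lspan A M))"
      by (rule is_subring_multipliers[OF is_submodule_lspan[OF A] A])
    then show ?thesis
      using M integral_over_multipliers[OF A M(1,2)] by (auto intro: subring_intros)
  qed
  then show ?thesis
    using integral_over_self[OF A subring_one[OF A]] by (auto simp: is_subring_def)
qed

lemma integral_over_trans:
  fixes A :: "'a::field set"
  assumes A: "is_subring A" and y: "integral_over {x. integral_over A x} y"
  shows "integral_over A y"
proof -
  obtain p where p: "p \<in> polys_over {x. integral_over A x}" "lead_coeff p = 1" "poly p y = 0"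
    using y unfolding integral_over_def by blast
  have "set (coeffs p) \<subseteq> range (coeff p)"
    by (simp add: range_coeff subset_insertI)
  then have "integral_over A c" if "c \<in> set (coeffs p)" for c
    using that p(1) by (auto simp: polys_over_def)
  then obtain M where M: "finite M" "1 \<in> lspan A M" "set (coeffs p) \<subseteq> multipliers (lspan A M)"
    using finite_integral_multipliers[OF A, of "set (coeffs p)"] by auto
  have "0 \<in> multipliers (lspan A M)"
    using is_submodule_lspan[OF A, of M] by (auto simp: is_submodule_def multipliers_def)
  then have "p \<in> polys_over (multipliers (lspan A M))"
    using M(3) range_coeff[of p] by (intro polys_overI) (metis insertE rangeI subsetD)
  then have "integral_over (multipliers (lspan A M)) y"
    using p unfolding integral_over_def by blast
  from extend_multipliers[OF A M(1,2) this] integral_over_multipliers[OF A] show ?thesis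
    by (metis insert_subset)
qed

lemma subset_subring_hull: "S \<subseteq> is_subring hull S"
  by (rule hull_subset)

lemma subring_hull_minimal: "is_subring B \<Longrightarrow> S \<subseteq> B \<Longrightarrow> is_subring hull S \<subseteq> B"
  by (rule hull_minimal)

lemma subring_hull_insert_eq:
  assumes A: "is_subring A"
  shows "is_subring hull (insert x A) = {poly p x |p. p \<in> polys_over A}"
proof (rule hull_unique)
  show "insert x A \<subseteq> {poly p x |p. p \<in> polys_over A}"
  proof
    fix y assume "y \<in> insert x A"
    then consider "y = x" | "y \<in> A" by auto
    then show "y \<in> {poly p x |p. p \<in> polys_over A}"
    proof cases
      case 1
      then show ?thesis using polys_over_X[OF A] by (auto intro!: exI[where x = "[:0, 1:]"])
    next
      case 2
      then show ?thesis using polys_over_const[OF A] by (auto intro!: exI[where x = "[:y:]"])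
    qed
  qed
  have PA: "is_subring (polys_over A)" by (rule is_subring_polys_over[OF A])
  show "is_subring {poly p x |p. p \<in> polys_over A}"
    unfolding is_subring_def[of "{poly p x |p. p \<in> polys_over A}"]
  proof (intro conjI ballI)
    show "1 \<in> {poly p x |p. p \<in> polys_over A}"
      using subring_one[OF PA] by (intro CollectI exI[of _ 1]) auto
    fix a b
    assume "a \<in> {poly p x |p. p \<in> polys_over A}" "b \<in> {poly p x |p. p \<in> polys_over A}"
    then obtain p q where pq: "p \<in> polys_over A" "q \<in> polys_over A" "a = poly p x" "b = poly q x"
      by blast
    show "a - b \<in> {poly p x |p. p \<in> polys_over A}"
      using pq subring_diff[OF PA] by (intro CollectI exI[of _ "p - q"]) auto
    show "a * b \<in> {poly p x |p. p \<in> polys_over A}"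
      using pq subring_mult[OF PA] by (intro CollectI exI[of _ "p * q"]) auto
  qed
next
  fix B assume "insert x A \<subseteq> B" "is_subring B"
  then show "{poly p x |p. p \<in> polys_over A} \<subseteq> B"
    using poly_mem_subring[of B] polys_over_mono[of A B] by auto
qed

section \<open>Hilbert's basis theorem\<close>

definition is_ideal :: "'a::comm_ring_1 set \<Rightarrow> 'a set \<Rightarrow> bool" where
  "is_ideal A J \<longleftrightarrow> J \<subseteq> A \<and> is_submodule A J"

definition noetherian :: "'a::comm_ring_1 set \<Rightarrow> bool" where
  "noetherian A \<longleftrightarrow> is_subring A \<and> (\<forall>J. is_ideal A J \<longrightarrow> (\<exists>G. finite G \<and> J = lspan A G))"

lemma noetherian_subfield:
  assumes k: "is_subfield k"
  shows "noetherian k"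
  unfolding noetherian_def
proof (intro conjI allI impI)
  show sk: "is_subring k" using k by (simp add: is_subfield_def)
  fix J assume J: "is_ideal k J"
  show "\<exists>G. finite G \<and> J = lspan k G"
  proof (cases "J \<subseteq> {0}")
    case True
    then have "J = {0}" using J by (auto simp: is_ideal_def is_submodule_def)
    then show ?thesis by (intro exI[of _ "{}"]) (auto simp: lspan_def subring_zero[OF sk] intro: exI[of _ "\<lambda>_. 0"])
  next
    case False
    then obtain a where a: "a \<in> J" "a \<noteq> 0" by auto
    have "J = lspan k {a}"
    proof (intro equalityI subsetI)
      fix x assume "x \<in> J"
      then have "x * inverse a \<in> k"
        using J a k by (auto simp: is_ideal_def is_subfield_def is_subring_def subset_eq)
      then show "x \<in> lspan k {a}"
        unfolding lspan_def using a subring_zero[OF sk]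
        by (intro CollectI exI[of _ "\<lambda>_. x * inverse a"]) auto
    next
      fix x assume "x \<in> lspan k {a}"
      then show "x \<in> J"
        using J a lspan_minimal[of k J "{a}"] by (auto simp: is_ideal_def)
    qed
    then show ?thesis by blast
  qed
qed

text \<open>
  For an ideal \<open>J\<close> of \<open>A[x]\<close> let \<open>L n\<close> be the ideal of all \<open>n\<close>-th coefficients of polynomials of
  degree at most \<open>n\<close> with value at \<open>x\<close> in \<open>J\<close>. The chain \<open>L\<close> becomes stationary, and polynomials
  that realise generators of the finitely many different \<open>L n\<close> generate \<open>J\<close>: a leading
  coefficient is cancelled at the cost of lowering the degree.
\<close>

lemma hilbert_basis:
  fixes A :: "'a::comm_ring_1 set"
  assumes noeth: "noetherian A"
  shows "noetherian (is_subring hull (insert x A))"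
  unfolding noetherian_def
proof (intro conjI allI impI)
  define B where "B = is_subring hull (insert x A)"
  have A: "is_subring A" using noeth by (simp add: noetherian_def)
  have B: "is_subring B" unfolding B_def by (rule is_subring_hull)
  show "is_subring (is_subring hull (insert x A))" by (rule is_subring_hull)
  have xB: "x \<in> B" and AB: "A \<subseteq> B"
    unfolding B_def using subset_subring_hull[of "insert x A"] by auto
  have Beq: "B = {poly p x |p. p \<in> polys_over A}"
    unfolding B_def by (rule subring_hull_insert_eq[OF A])
  fix J assume "is_ideal (is_subring hull (insert x A)) J"
  then have J: "J \<subseteq> B" "is_submodule B J" by (auto simp: is_ideal_def B_def)
  define P where "P n = {p \<in> polys_over A. degree p \<le> n \<and> poly p x \<in> J}" for n
  define L where "L n = (\<lambda>p. coeff p n) ` P n" for n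
  have PA: "is_subring (polys_over A)" by (rule is_subring_polys_over[OF A])
  have P0: "0 \<in> P n" for n
    using J subring_zero[OF PA] by (auto simp: P_def is_submodule_def)
  have Padd: "p + q \<in> P n" if "p \<in> P n" "q \<in> P n" for p q n
    using that J subring_add[OF PA] by (auto simp: P_def is_submodule_def degree_add_le)
  have Psmult: "smult a p \<in> P n" if "a \<in> A" "p \<in> P n" for a p n
    using that J AB subring_mult[OF A]
    by (auto simp: P_def is_submodule_def polys_over_def intro: order_trans[OF degree_smult_le])
  have Psucc: "pCons 0 p \<in> P (Suc n)" if "p \<in> P n" for p n
    using that J xB subring_zero[OF A]
    by (auto simp: P_def is_submodule_def polys_over_def coeff_pCons degree_pCons_eq_if
        split: nat.split)
  have Lideal: "is_ideal A (L n)" for n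
    unfolding is_ideal_def is_submodule_def
  proof (intro conjI ballI)
    show "L n \<subseteq> A" by (auto simp: L_def P_def polys_over_def)
    show "0 \<in> L n" unfolding L_def using P0 by (intro image_eqI[of _ _ 0]) auto
    fix c d assume "c \<in> L n" "d \<in> L n"
    then obtain p q where "p \<in> P n" "q \<in> P n" "c = coeff p n" "d = coeff q n"
      by (auto simp: L_def)
    then show "c + d \<in> L n" unfolding L_def using Padd by (intro image_eqI[of _ _ "p + q"]) auto
  next
    fix a c assume "a \<in> A" "c \<in> L n"
    then obtain p where "p \<in> P n" "c = coeff p n" by (auto simp: L_def)
    then show "a * c \<in> L n"
      unfolding L_def using Psmult \<open>a \<in> A\<close> by (intro image_eqI[of _ _ "smult a p"]) auto
  qed
  have Lsucc: "L n \<subseteq> L (Suc n)" for n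
  proof
    fix c assume "c \<in> L n"
    then obtain p where "p \<in> P n" "c = coeff p n" by (auto simp: L_def)
    then show "c \<in> L (Suc n)"
      unfolding L_def using Psucc by (intro image_eqI[of _ _ "pCons 0 p"]) auto
  qed
  have Lmono: "L m \<subseteq> L n" if "m \<le> n" for m n
    by (rule lift_Suc_mono_le[of L, OF Lsucc that])
  have Uideal: "is_ideal A (\<Union>n. L n)"
    unfolding is_ideal_def is_submodule_def
  proof (intro conjI ballI)
    show "(\<Union>n. L n) \<subseteq> A" using Lideal unfolding is_ideal_def by blast
    show "0 \<in> (\<Union>n. L n)" using Lideal by (auto simp: is_ideal_def is_submodule_def)
    fix c d assume "c \<in> (\<Union>n. L n)" "d \<in> (\<Union>n. L n)"
    then obtain m n where "c \<in> L m" "d \<in> L n" by auto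
    then have "c \<in> L (max m n)" "d \<in> L (max m n)"
      using Lmono[of m "max m n"] Lmono[of n "max m n"] by auto
    then show "c + d \<in> (\<Union>n. L n)"
      using Lideal[of "max m n"] by (auto simp: is_ideal_def is_submodule_def)
  next
    fix a c assume "a \<in> A" "c \<in> (\<Union>n. L n)"
    then show "a * c \<in> (\<Union>n. L n)"
      using Lideal unfolding is_ideal_def is_submodule_def by blast
  qed
  then obtain G where G: "finite G" "(\<Union>n. L n) = lspan A G"
    using noeth by (auto simp: noetherian_def)
  have "\<exists>n. g \<in> L n" if "g \<in> G" for g
    using lspan_inc[OF A G(1) that] G(2) by auto
  then obtain idx where idx: "\<And>g. g \<in> G \<Longrightarrow> g \<in> L (idx g)" by metis
  obtain N where N: "\<forall>g\<in>G. idx g \<le> N"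
    using finite_imageI[OF G(1), of idx] by (metis finite_nat_set_iff_bounded_le imageI)
  have "G \<subseteq> L N" using idx N Lmono by blast
  then have "lspan A G \<subseteq> L N"
    using Lideal[of N] by (intro lspan_minimal) (auto simp: is_ideal_def)
  then have stat: "L n \<subseteq> L N" for n using G(2) by auto
  have "\<exists>H. finite H \<and> L n = lspan A H" for n
    using Lideal noeth by (auto simp: noetherian_def)
  then obtain H where H: "\<And>n. finite (H n)" "\<And>n. L n = lspan A (H n)" by metis
  have ex_f: "\<exists>p. p \<in> P n \<and> coeff p n = h" if "h \<in> H n" for n h
  proof -
    have "h \<in> L n" using lspan_inc[OF A H(1) that] H(2) by simp
    then show ?thesis by (auto simp: L_def)
  qed
  define f where "f n h = (SOME p. p \<in> P n \<and> coeff p n = h)" for n h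
  have f: "f n h \<in> P n" "coeff (f n h) n = h" if "h \<in> H n" for n h
    using someI_ex[OF ex_f[OF that]] by (auto simp: f_def)
  define F where "F = (\<Union>n\<le>N. (\<lambda>h. poly (f n h) x) ` H n)"
  have fin: "finite F" unfolding F_def using H(1) by auto
  have smF: "is_submodule B (lspan B F)" by (rule is_submodule_lspan[OF B])
  (* For n <= N the leading coefficient is a combination of the chosen generators of L n; beyond N,
     where L n = L N, a polynomial of degree N is multiplied by a power of x. *)
  have lead: "\<exists>q. q \<in> P n \<and> coeff q n = c \<and> poly q x \<in> lspan B F" if c: "c \<in> L n" "n \<le> N" for c n
  proof -
    obtain a where a: "c = (\<Sum>h\<in>H n. a h * h)" "\<forall>h. a h \<in> A"
      using c H(2) unfolding lspan_def by blast
    define q where "q = (\<Sum>h\<in>H n. smult (a h) (f n h))"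
    have "q \<in> P n"
    proof -
      have "(\<Sum>h\<in>K. smult (a h) (f n h)) \<in> P n" if "finite K" "K \<subseteq> H n" for K
        using that by (induction K rule: finite_induct) (auto simp: P0 Padd Psmult a f)
      then show ?thesis unfolding q_def using H(1) by auto
    qed
    moreover have "coeff q n = c" unfolding q_def a by (simp add: coeff_sum f)
    moreover have "poly q x \<in> lspan B F"
    proof -
      have "poly (f n h) x \<in> lspan B F" if "h \<in> H n" for h
        by (rule lspan_inc[OF B fin]) (use that c in \<open>auto simp: F_def\<close>)
      then show ?thesis
        unfolding q_def poly_sum poly_smult
        using a AB by (intro submodule_sum[OF smF] submodule_smult[OF smF]) blast+
    qed
    ultimately show ?thesis by blast
  qed
  have lead': "\<exists>q. q \<in> P n \<and> coeff q n = c \<and> poly q x \<in> lspan B F" if c: "c \<in> L n" for c n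
  proof (cases "n \<le> N")
    case True
    then show ?thesis using lead c by blast
  next
    case False
    then obtain q where q: "q \<in> P N" "coeff q N = c" "poly q x \<in> lspan B F"
      using lead[of c N] c stat by blast
    have "\<exists>q. q \<in> P (N + i) \<and> coeff q (N + i) = c \<and> poly q x \<in> lspan B F" for i
    proof (induction i)
      case 0
      then show ?case using q by auto
    next
      case (Suc i)
      then obtain q where "q \<in> P (N + i)" "coeff q (N + i) = c" "poly q x \<in> lspan B F" by blast
      then show ?case
        using Psucc[of q "N + i"] smF xB
        by (intro exI[of _ "pCons 0 q"]) (auto intro: submodule_smult)
    qed
    from this[of "n - N"] show ?thesis using False by simp
  qed
  have main: "poly p x \<in> lspan B F" if "p \<in> P n" for p n
    using that
  proof (induction n arbitrary: p)
    case 0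
    then obtain q where q: "q \<in> P 0" "coeff q 0 = coeff p 0" "poly q x \<in> lspan B F"
      using lead'[of "coeff p 0" 0] unfolding L_def by blast
    have "degree p = 0" "degree q = 0" using 0 q by (auto simp: P_def)
    then have "p = q" using q(2) by (metis degree_eq_zeroE coeff_pCons_0)
    then show ?case using q by simp
  next
    case (Suc n)
    then obtain q where q: "q \<in> P (Suc n)" "coeff q (Suc n) = coeff p (Suc n)" "poly q x \<in> lspan B F"
      using lead'[of "coeff p (Suc n)" "Suc n"] unfolding L_def by blast
    have "- 1 \<in> A" by (intro subring_uminus subring_one A)
    then have pq: "p - q \<in> P (Suc n)"
      using Padd[OF Suc.prems Psmult[OF _ q(1)], of "- 1"] by simp
    moreover have "degree (p - q) \<le> n"
    proof (rule degree_le, intro allI impI)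
      fix i assume "n < i"
      then consider "i = Suc n" | "Suc n < i" by linarith
      then show "coeff (p - q) i = 0"
        using q(2) pq coeff_eq_0[of "p - q" i] by cases (auto simp: P_def)
    qed
    ultimately have "poly (p - q) x \<in> lspan B F" by (intro Suc.IH) (auto simp: P_def)
    then have "poly (p - q) x + poly q x \<in> lspan B F"
      using q(3) by (rule submodule_add[OF smF])
    then show ?case by simp
  qed
  have "J = lspan B F"
  proof (intro equalityI)
    have "F \<subseteq> J" using f(1) unfolding F_def P_def by blast
    then show "lspan B F \<subseteq> J" by (rule lspan_minimal[OF J(2)])
    show "J \<subseteq> lspan B F"
    proof
      fix y assume "y \<in> J"
      then obtain p where "p \<in> polys_over A" "y = poly p x" using J Beq by auto
      then show "y \<in> lspan B F" using main[of p "degree p"] \<open>y \<in> J\<close> by (auto simp: P_def)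
    qed
  qed
  then show "\<exists>G. finite G \<and> J = lspan (is_subring hull (insert x A)) G"
    using fin unfolding B_def by blast
qed

lemma subring_hull_Un_insert:
  "is_subring hull (insert x (is_subring hull S)) = is_subring hull (insert x S)"
  using hull_Un_right[of is_subring "{x}" S] by simp

lemma noetherian_affine_domain:
  assumes k: "is_subfield k" and B: "affine_domain k B"
  shows "noetherian B"
proof -
  have "noetherian (is_subring hull (k \<union> S))" if "finite S" for S
    using that
  proof (induction S rule: finite_induct)
    case empty
    then show ?case
      using noetherian_subfield[OF k] k hull_same[of is_subring k] by (simp add: is_subfield_def)
  next
    case (insert x S)
    then show ?case
      using hilbert_basis[of "is_subring hull (k \<union> S)" x] by (simp add: subring_hull_Un_insert)
  qed
  then show ?thesis using B by (auto simp: affine_domain_def)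
qed

section \<open>Integral equations, fractions and homomorphisms\<close>

lemma integral_over_iff:
  "integral_over A x \<longleftrightarrow> (\<exists>n a. (\<forall>i<n. a i \<in> A) \<and> x ^ n + (\<Sum>i<n. a i * x ^ i) = 0)"
  if A: "is_subring A"
proof
  assume "integral_over A x"
  then obtain p where p: "p \<in> polys_over A" "lead_coeff p = 1" "poly p x = 0"
    unfolding integral_over_def by blast
  have "x ^ degree p + (\<Sum>i<degree p. coeff p i * x ^ i) = 0"
    using p(2,3) by (simp add: poly_altdef lessThan_Suc_atMost[symmetric] add.commute)
  then show "\<exists>n a. (\<forall>i<n. a i \<in> A) \<and> x ^ n + (\<Sum>i<n. a i * x ^ i) = 0"
    using p(1) by (intro exI[of _ "degree p"] exI[of _ "coeff p"]) (auto simp: polys_over_def)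
next
  assume "\<exists>n a. (\<forall>i<n. a i \<in> A) \<and> x ^ n + (\<Sum>i<n. a i * x ^ i) = 0"
  then obtain n a where a: "\<And>i. i < n \<Longrightarrow> a i \<in> A" "x ^ n + (\<Sum>i<n. a i * x ^ i) = 0" by blast
  define p where "p = monom 1 n + (\<Sum>i<n. monom (a i) i)"
  have cp: "coeff p i = (if i = n then 1 else if i < n then a i else 0)" for i
    unfolding p_def by (auto simp: coeff_sum)
  have "degree p \<le> n" by (rule degree_le) (simp add: cp)
  then have "degree p = n" using le_degree[of p n] cp[of n]
    by (metis dual_order.antisym zero_neq_one)
  then have "lead_coeff p = 1" by (simp add: cp)
  moreover have "p \<in> polys_over A"
    using a(1) by (auto intro!: polys_overI simp: cp subring_zero[OF A] subring_one[OF A])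
  moreover have "poly p x = 0" using a(2) by (simp add: p_def poly_sum poly_monom)
  ultimately show "integral_over A x" unfolding integral_over_def by blast
qed

lemma normal_domain_iff:
  "normal_domain B \<longleftrightarrow> is_subring B \<and> (\<forall>x\<in>Frac B. integral_over B x \<longrightarrow> x \<in> B)"
  unfolding normal_domain_def integral_over_def polys_over_def by blast

lemma (in comm_ring_hom) is_subring_image:
  assumes "is_subring A"
  shows "is_subring (hom ` A)"
  unfolding is_subring_def[of "hom ` A"]
proof (intro conjI ballI)
  show "1 \<in> hom ` A" using subring_one[OF assms] hom_one by (metis imageI)
  fix x y assume "x \<in> hom ` A" "y \<in> hom ` A"
  then obtain a b where ab: "a \<in> A" "b \<in> A" "x = hom a" "y = hom b" by blast
  show "x - y \<in> hom ` A"
    using ab subring_diff[OF assms] by (intro image_eqI[of _ _ "a - b"]) (auto simp: hom_distribs)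
  show "x * y \<in> hom ` A"
    using ab subring_mult[OF assms] by (intro image_eqI[of _ _ "a * b"]) (auto simp: hom_distribs)
qed

lemma (in comm_ring_hom) integral_over_image:
  assumes A: "is_subring A" and x: "integral_over A x"
  shows "integral_over (hom ` A) (hom x)"
proof -
  obtain n a where a: "\<And>i. i < n \<Longrightarrow> a i \<in> A" "x ^ n + (\<Sum>i<n. a i * x ^ i) = 0"
    using x unfolding integral_over_iff[OF A] by blast
  have "hom x ^ n + (\<Sum>i<n. hom (a i) * hom x ^ i) = hom (x ^ n + (\<Sum>i<n. a i * x ^ i))"
    by (simp add: hom_distribs)
  also have "\<dots> = 0" by (simp add: a(2))
  finally show ?thesis
    unfolding integral_over_iff[OF is_subring_image[OF A]] using a(1)
    by (intro exI[of _ n] exI[of _ "\<lambda>i. hom (a i)"]) auto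
qed

lemma (in inj_comm_ring_hom) integral_over_image_iff:
  assumes A: "is_subring A"
  shows "integral_over (hom ` A) (hom x) \<longleftrightarrow> integral_over A x"
proof
  assume "integral_over (hom ` A) (hom x)"
  then obtain n a where a: "\<And>i. i < n \<Longrightarrow> a i \<in> hom ` A"
    "hom x ^ n + (\<Sum>i<n. a i * hom x ^ i) = 0"
    unfolding integral_over_iff[OF is_subring_image[OF A]] by blast
  have "\<exists>c. c \<in> A \<and> a i = hom c" if "i < n" for i using a(1)[OF that] by blast
  then obtain b where b: "\<And>i. i < n \<Longrightarrow> b i \<in> A" "\<And>i. i < n \<Longrightarrow> a i = hom (b i)" by metis
  have "hom (x ^ n + (\<Sum>i<n. b i * x ^ i)) = hom x ^ n + (\<Sum>i<n. a i * hom x ^ i)"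
    by (simp add: hom_distribs b(2))
  then have "x ^ n + (\<Sum>i<n. b i * x ^ i) = 0" using a(2) by simp
  then show "integral_over A x" unfolding integral_over_iff[OF A] using b(1) by blast
qed (rule integral_over_image[OF A])

lemma subset_Frac: "is_subring A \<Longrightarrow> A \<subseteq> Frac A"
  unfolding Frac_def using subring_one[of A] by force

lemma Frac_mono: "A \<subseteq> B \<Longrightarrow> Frac A \<subseteq> Frac B"
  unfolding Frac_def by blast

lemma is_subfield_Frac:
  assumes A: "is_subring A"
  shows "is_subfield (Frac A)"
  unfolding is_subfield_def is_subring_def
proof (intro conjI ballI)
  show "1 \<in> Frac A" using subset_Frac[OF A] subring_one[OF A] by auto
  fix x y assume "x \<in> Frac A" "y \<in> Frac A"
  then obtain a b c d where *: "x = a / b" "y = c / d" "a \<in> A" "b \<in> A" "c \<in> A" "d \<in> A" "b \<noteq> 0" "d \<noteq> 0"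
    unfolding Frac_def by blast
  have FracI: "u / (b * d) \<in> Frac A" if "u \<in> A" for u
    unfolding Frac_def using * that subring_mult[OF A]
    by (intro CollectI exI[of _ u] exI[of _ "b * d"]) auto
  have "x - y = (a * d - c * b) / (b * d)" "x * y = (a * c) / (b * d)"
    using * by (auto simp: field_simps)
  then show "x - y \<in> Frac A" "x * y \<in> Frac A"
    using FracI * subring_mult[OF A] subring_diff[OF A] by auto
next
  fix x assume "x \<in> Frac A"
  then obtain a b where *: "x = a / b" "a \<in> A" "b \<in> A" "b \<noteq> 0" unfolding Frac_def by blast
  show "inverse x \<in> Frac A"
  proof (cases "a = 0")
    case True
    then show ?thesis using * subset_Frac[OF A] by auto
  next
    case False
    then show ?thesis unfolding Frac_def using * by (intro CollectI exI[of _ b] exI[of _ a]) auto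
  qed
qed

lemma subfield_divide: "is_subfield F \<Longrightarrow> x \<in> F \<Longrightarrow> y \<in> F \<Longrightarrow> x / y \<in> F"
  unfolding is_subfield_def is_subring_def by (metis divide_inverse)

lemma Frac_minimal: "is_subfield F \<Longrightarrow> A \<subseteq> F \<Longrightarrow> Frac A \<subseteq> F"
  unfolding Frac_def using subfield_divide by blast

lemma subfield_subring: "is_subfield F \<Longrightarrow> is_subring F"
  by (simp add: is_subfield_def)

lemma subfield_inverse: "is_subfield F \<Longrightarrow> x \<in> F \<Longrightarrow> inverse x \<in> F"
  by (simp add: is_subfield_def)

lemma Frac_subfield: "is_subfield F \<Longrightarrow> Frac F = F"
  using Frac_minimal[of F F] subset_Frac[of F] subfield_subring by blast

lemma normal_domain_subfield: "is_subfield F \<Longrightarrow> normal_domain F"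
  by (simp add: normal_domain_iff Frac_subfield subfield_subring)

text \<open>
  Multiply the equation of degree \<open>n\<close> for \<open>1/w\<close> by \<open>w\<^bsup>n-1\<^esup>\<close>.
\<close>

lemma integral_inverse_mem:
  fixes B :: "'a::field set"
  assumes B: "is_subring B" and w: "w \<in> B" "integral_over B (inverse w)"
  shows "inverse w \<in> B"
proof (cases "w = 0")
  case False
  obtain n a where a: "\<And>i. i < n \<Longrightarrow> a i \<in> B" "inverse w ^ n + (\<Sum>i<n. a i * inverse w ^ i) = 0"
    using w(2) unfolding integral_over_iff[OF B] by blast
  show ?thesis
  proof (cases n)
    case 0
    then show ?thesis using a by simp
  next
    case (Suc m)
    have cancel: "w ^ j * inverse w ^ j = 1" for j
      using False by (simp flip: power_mult_distrib)
    have "inverse w + (\<Sum>i<n. a i * w ^ (m - i)) = w ^ m * (inverse w ^ n + (\<Sum>i<n. a i * inverse w ^ i))"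
      unfolding distrib_left sum_distrib_left
    proof (intro arg_cong2[of _ _ _ _ "(+)"] sum.cong refl)
      show "inverse w = w ^ m * inverse w ^ n" using cancel[of m] by (simp add: Suc ac_simps)
      fix i assume "i \<in> {..<n}"
      then have "w ^ m = w ^ (m - i) * w ^ i" by (simp add: Suc flip: power_add)
      then show "a i * w ^ (m - i) = w ^ m * (a i * inverse w ^ i)"
        using cancel[of i] by (simp add: ac_simps)
    qed
    then have "inverse w = - (\<Sum>i<n. a i * w ^ (m - i))" using a(2) by (simp add: eq_neg_iff_add_eq_0)
    then show ?thesis using a(1) w by (auto intro!: subring_intros B)
  qed
qed (simp add: subring_zero[OF B])

section \<open>Polynomials over a subfield\<close>

text \<open>
  \<open>E\<close> is only a subset of a field type, so the division in the type \<open>'a poly\<close> says nothing about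
  the coefficients of quotient and remainder.
\<close>

lemma polys_over_division:
  fixes E :: "'a::field set"
  assumes E: "is_subfield E" and q: "q \<in> polys_over E" "q \<noteq> 0" and p: "p \<in> polys_over E"
  shows "\<exists>d\<in>polys_over E. \<exists>r\<in>polys_over E. p = q * d + r \<and> (r = 0 \<or> degree r < degree q)"
  using p
proof (induction "degree p" arbitrary: p rule: less_induct)
  case less
  have PE: "is_subring (polys_over E)" by (rule is_subring_polys_over[OF subfield_subring[OF E]])
  show ?case
  proof (cases "p = 0 \<or> degree p < degree q")
    case True
    then show ?thesis using less.prems subring_zero[OF PE] by (intro bexI[of _ 0] bexI[of _ p]) auto
  next
    case False
    define t where "t = monom (lead_coeff p / lead_coeff q) (degree p - degree q)"
    have t: "t \<in> polys_over E"
      unfolding t_def using less.prems q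
      by (intro polys_over_monom subfield_subring E subfield_divide) (auto simp: polys_over_def)
    define p' where "p' = p - q * t"
    have p': "p' \<in> polys_over E" unfolding p'_def by (intro subring_intros PE less.prems q t)
    have lc: "lead_coeff q \<noteq> 0" using q by simp
    have tn: "t \<noteq> 0" unfolding t_def using False lc by simp
    have deg: "degree (q * t) = degree p"
      using degree_mult_eq[OF q(2) tn] False lc by (simp add: t_def degree_monom_eq)
    have "coeff p' (degree p) = 0"
      using coeff_mult_degree_sum[of q t] deg degree_mult_eq[OF q(2) tn] False lc
      by (simp add: p'_def t_def degree_monom_eq)
    moreover have "degree p' \<le> degree p" unfolding p'_def by (rule degree_diff_le) (auto simp: deg)
    ultimately have small: "p' = 0 \<or> degree p' < degree p"
      by (metis le_neq_implies_less leading_coeff_0_iff)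
    have "\<exists>d\<in>polys_over E. \<exists>r\<in>polys_over E. p' = q * d + r \<and> (r = 0 \<or> degree r < degree q)"
    proof (cases "p' = 0")
      case True
      then show ?thesis using subring_zero[OF PE] by (intro bexI[of _ 0]) auto
    next
      case False
      then show ?thesis using less.hyps[of p'] small p' by blast
    qed
    then obtain d r where "d \<in> polys_over E" "r \<in> polys_over E" "p' = q * d + r"
      "r = 0 \<or> degree r < degree q" by blast
    then show ?thesis
      by (intro bexI[of _ "d + t"] bexI[of _ r]) (auto simp: p'_def algebra_simps subring_add[OF PE] t)
  qed
qed

text \<open>
  Besides the greatest common divisor \<open>g\<close>, the Euclidean algorithm provides the coprime cofactors
  \<open>p'\<close> and \<open>q'\<close>, which serve to reduce the fraction \<open>p / q\<close>.
\<close>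

lemma polys_over_bezout:
  fixes E :: "'a::field set"
  assumes E: "is_subfield E" and q: "q \<in> polys_over E" "q \<noteq> 0" and p: "p \<in> polys_over E"
  shows "\<exists>g p' q' u v. {g, p', q', u, v} \<subseteq> polys_over E \<and> p = g * p' \<and> q = g * q' \<and> u * p' + v * q' = 1"
  using q p
proof (induction "degree q" arbitrary: p q rule: less_induct)
  case less
  have PE: "is_subring (polys_over E)" by (rule is_subring_polys_over[OF subfield_subring[OF E]])
  obtain d r where dr: "d \<in> polys_over E" "r \<in> polys_over E" "p = q * d + r" "r = 0 \<or> degree r < degree q"
    using polys_over_division[OF E less.prems] by blast
  show ?case
  proof (cases "r = 0")
    case True
    then show ?thesis
      using dr less.prems subring_zero[OF PE] subring_one[OF PE]
      by (intro exI[of _ q] exI[of _ d] exI[of _ 1] exI[of _ 0]) auto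
  next
    case False
    then obtain g q' r' u v where *: "{g, q', r', u, v} \<subseteq> polys_over E" "q = g * q'" "r = g * r'"
      "u * q' + v * r' = 1"
      using less.hyps[of r q] dr less.prems by blast
    have "p = g * (q' * d + r')" using dr * by (simp add: algebra_simps)
    moreover have "v * (q' * d + r') + (u - v * d) * q' = 1" using *(4) by (simp add: algebra_simps)
    moreover have "{g, q' * d + r', q', v, u - v * d} \<subseteq> polys_over E"
      using * dr by (auto intro!: subring_add[OF PE] subring_mult[OF PE] subring_diff[OF PE])
    ultimately show ?thesis using *(2) by blast
  qed
qed

section \<open>Polynomial rings over normal domains\<close>

text \<open>
  Finite differences lower the degree and multiply the leading coefficient by the degree, so the
  leading coefficient is determined by integer values up to division by a positive integer.
\<close>

lemma coeff_mem_if_nat_values_mem: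
  fixes g :: "'a::comm_ring_1 poly"
  assumes M0: "0 \<in> M" and diff: "\<And>x y. x \<in> M \<Longrightarrow> y \<in> M \<Longrightarrow> x - y \<in> M"
    and div: "\<And>n x. 0 < n \<Longrightarrow> of_nat n * x \<in> M \<Longrightarrow> x \<in> M"
    and val: "\<And>j. 0 < j \<Longrightarrow> poly g (of_nat j) \<in> M"
  shows "coeff g i \<in> M"
proof -
  have add: "x + y \<in> M" if "x \<in> M" "y \<in> M" for x y
    using diff[OF that(1) diff[OF M0 that(2)]] by simp
  have nat_mult: "of_nat n * x \<in> M" if "x \<in> M" for n x
    using that by (induction n) (auto simp: M0 add distrib_right)
  have "\<forall>i. coeff g i \<in> M" if "degree g \<le> n" "\<And>j. 0 < j \<Longrightarrow> poly g (of_nat j) \<in> M" for n g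
    using that
  proof (induction n arbitrary: g)
    case 0
    then obtain c where g: "g = [:c:]" using degree_eq_zeroE by blast
    with 0(2)[of 1] have "c \<in> M" by simp
    then show ?case by (simp add: g coeff_pCons M0 split: nat.split)
  next
    case (Suc n)
    define c where "c = coeff g (Suc n)"
    define h where "h = pcompose g [:1, 1:] - g"
    have gsum: "g = (\<Sum>i\<le>Suc n. monom (coeff g i) i)"
      by (rule poly_as_sum_of_monoms'[OF Suc.prems(1), symmetric])
    have mono: "pcompose (monom a i) [:1, 1:] = smult a ([:1, 1:] ^ i)" for a :: 'a and i
      by (induction i) (auto simp: monom_0 monom_Suc pcompose_pCons mult_smult_right)
    have "pcompose g [:1, 1:] = (\<Sum>i\<le>Suc n. smult (coeff g i) ([:1, 1:] ^ i))"
      by (subst gsum) (simp only: pcompose_sum mono)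
    moreover have "coeff ([:1, 1:] ^ i) k = (of_nat (i choose k) :: 'a)" for i k
      using coeff_linear_poly_power[of k i "1 :: 'a" 1]
        degree_power_le[of "[:1, 1 :: 'a:]" i]
      by (cases "k \<le> i") (auto simp: binomial_eq_0 intro: coeff_eq_0)
    ultimately have ch: "coeff h k = (\<Sum>i\<le>Suc n. coeff g i * of_nat (i choose k)) - coeff g k" for k
      by (simp add: h_def coeff_sum del: sum.atMost_Suc)
    have "degree h \<le> n"
    proof (rule degree_le, intro allI impI)
      fix k assume k: "n < k"
      have "(\<Sum>i\<le>Suc n. coeff g i * of_nat (i choose k)) = (\<Sum>i\<le>Suc n. if i = k then coeff g i else 0)"
        by (rule sum.cong) (use k in \<open>auto simp: binomial_eq_0\<close>)
      also have "\<dots> = coeff g k"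
        using k Suc.prems(1) by (auto simp: coeff_eq_0 not_le)
      finally show "coeff h k = 0" by (simp add: ch)
    qed
    moreover have "poly h (of_nat j) \<in> M" if "0 < j" for j
      using diff[OF Suc.prems(2)[of "Suc j"] Suc.prems(2)[of j]] that
      by (simp add: h_def poly_pcompose add.commute)
    ultimately have hM: "coeff h n \<in> M" using Suc.IH[of h] by blast
    have "(\<Sum>i<n. coeff g i * of_nat (i choose n)) = 0" by (rule sum.neutral) (simp add: binomial_eq_0)
    then have "coeff h n = of_nat (Suc n) * c"
      by (simp add: ch c_def lessThan_Suc_atMost[symmetric] algebra_simps)
    then have cM: "c \<in> M" using div[of "Suc n" c] hM by simp
    define g' where "g' = g - monom c (Suc n)"
    have "degree g' \<le> n"
    proof (rule degree_le, intro allI impI)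
      fix k assume "n < k"
      then show "coeff g' k = 0"
        using Suc.prems(1) by (cases "k = Suc n") (auto simp: g'_def c_def coeff_eq_0)
    qed
    moreover have "poly g' (of_nat j) \<in> M" if "0 < j" for j
      using diff[OF Suc.prems(2)[OF that] nat_mult[OF cM, of "j ^ Suc n"]]
      by (simp add: g'_def poly_monom mult.commute del: power_Suc)
    ultimately have "\<forall>i. coeff g' i \<in> M" using Suc.IH[of g'] by blast
    then have "\<forall>i. coeff g' i + (if i = Suc n then c else 0) \<in> M" using add cM M0 by simp
    moreover have "coeff g i = coeff g' i + (if i = Suc n then c else 0)" for i
      by (auto simp: g'_def)
    ultimately show ?case by simp
  qed
  then show ?thesis using val by blast
qed

text \<open>
  With \<open>E = Frac A\<close>, the ring \<open>E[s]\<close> is integrally closed since it is a principal ideal domain.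
  An element \<open>g(s)\<close> of \<open>E[s]\<close> that is integral over \<open>A[s]\<close> takes values in \<open>A\<close> when the
  variable is replaced by an integer, because \<open>A\<close> is normal; so the coefficients of \<open>g\<close> lie in
  \<open>A\<close>, in which integers are invertible.
\<close>

lemma normal_domain_adjoin_transcendental:
  fixes A :: "'a::field_char_0 set"
  assumes nA: "normal_domain A" and Q: "\<And>n. inverse (of_nat n) \<in> A"
    and trans: "\<And>p. p \<in> polys_over (Frac A) \<Longrightarrow> poly p s = 0 \<Longrightarrow> p = 0"
  shows "normal_domain (is_subring hull (insert s A))"
proof -
  define E where "E = Frac A"
  have A: "is_subring A" using nA by (simp add: normal_domain_iff)
  have E: "is_subfield E" unfolding E_def by (rule is_subfield_Frac[OF A])
  have Er: "is_subring E" by (rule subfield_subring[OF E])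
  have AE: "A \<subseteq> E" unfolding E_def by (rule subset_Frac[OF A])
  have PE: "is_subring (polys_over E)" by (rule is_subring_polys_over[OF Er])
  define B where "B = is_subring hull (insert s A)"
  define B' where "B' = is_subring hull (insert s E)"
  have B: "B = {poly p s |p. p \<in> polys_over A}" and B': "B' = {poly p s |p. p \<in> polys_over E}"
    unfolding B_def B'_def by (rule subring_hull_insert_eq, fact)+
  have Br: "is_subring B" and Br': "is_subring B'" unfolding B_def B'_def by (rule is_subring_hull)+
  have BB': "B \<subseteq> B'" unfolding B_def B'_def by (rule hull_mono) (use AE in auto)
  have "f \<in> B" if f: "f \<in> Frac B" "integral_over B f" for f
  proof -
    obtain a b where ab: "f = a / b" "a \<in> B" "b \<in> B" "b \<noteq> 0" using f unfolding Frac_def by blast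
    obtain p where p: "a = poly p s" "p \<in> polys_over E" using ab(2) BB' B' by auto
    obtain q where q: "b = poly q s" "q \<in> polys_over E" using ab(3) BB' B' by auto
    have "q \<noteq> 0" using q ab by auto
    then obtain h p' q' u v where h: "{h, p', q', u, v} \<subseteq> polys_over E" "p = h * p'" "q = h * q'"
      "u * p' + v * q' = 1"
      using polys_over_bezout[OF E q(2) _ p(2)] by blast
    have nz: "poly q' s \<noteq> 0" "poly h s \<noteq> 0" using h(3) q ab by auto
    have fq: "f = poly p' s * inverse (poly q' s)"
      using nz by (simp add: ab(1) p q h(2,3) field_simps)
    have mem: "poly p' s \<in> B'" "poly q' s \<in> B'" "poly u s \<in> B'" "poly v s \<in> B'"
      using h(1) B' by auto
    have "poly u s * poly p' s + poly v s * poly q' s = 1"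
      using arg_cong[OF h(4), of "\<lambda>p. poly p s"] by simp
    (* The reduced denominator is a unit of E[s], since its inverse is integral over E[s]. *)
    then have "inverse (poly q' s) = poly u s * f + poly v s"
      using nz by (simp add: fq field_simps)
    moreover have "integral_over B' f" using f(2) integral_over_mono[OF BB'] by blast
    then have "poly u s * f + poly v s \<in> {x. integral_over B' x}"
      by (intro subring_add[OF is_subring_integral_closure[OF Br']]
          subring_mult[OF is_subring_integral_closure[OF Br']])
        (auto simp: integral_over_self[OF Br'] mem)
    ultimately have "inverse (poly q' s) \<in> B'"
      using integral_inverse_mem[OF Br' mem(2)] by simp
    then have "f \<in> B'" unfolding fq by (intro subring_mult[OF Br'] mem)
    then obtain g where g: "g \<in> polys_over E" "f = poly g s" using B' by auto
    obtain n c where c: "\<And>i. i < n \<Longrightarrow> c i \<in> B" "f ^ n + (\<Sum>i<n. c i * f ^ i) = 0"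
      using f(2) unfolding integral_over_iff[OF Br] by blast
    have "\<exists>r. r \<in> polys_over A \<and> c i = poly r s" if "i < n" for i using c(1)[OF that] B by auto
    then obtain r where r: "\<And>i. i < n \<Longrightarrow> r i \<in> polys_over A" "\<And>i. i < n \<Longrightarrow> c i = poly (r i) s"
      by metis
    (* By transcendence the integral equation for g(s) holds identically in s. *)
    define w where "w = g ^ n + (\<Sum>i<n. r i * g ^ i)"
    have "w \<in> polys_over E"
      unfolding w_def using g r(1) polys_over_mono[OF AE] by (intro subring_intros PE) auto
    moreover have "poly w s = 0" using c(2) by (simp add: w_def poly_sum g r(2))
    ultimately have w0: "w = 0" using trans by (auto simp: E_def)
    have val: "poly g (of_nat j) \<in> A" for j
    proof -
      have j: "of_nat j \<in> A" by (rule subring_of_nat[OF A])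
      have "poly w (of_nat j) = 0" by (simp add: w0)
      then have "integral_over A (poly g (of_nat j))"
        unfolding integral_over_iff[OF A] using r(1) poly_mem_subring[OF A _ j]
        by (intro exI[of _ n] exI[of _ "\<lambda>i. poly (r i) (of_nat j)"]) (auto simp: w_def poly_sum)
      moreover have "poly g (of_nat j) \<in> E" using poly_mem_subring[OF Er g(1)] j AE by blast
      ultimately show ?thesis using nA by (auto simp: normal_domain_iff E_def)
    qed
    have "coeff g i \<in> A" for i
    proof (rule coeff_mem_if_nat_values_mem[where M = A])
      show "x \<in> A" if "0 < m" "of_nat m * x \<in> A" for m x
        using subring_mult[OF A Q that(2), of m] that(1) by (simp add: field_simps)
    qed (use val in \<open>auto intro: subring_intros A\<close>)
    then show "f \<in> B" unfolding B g by (auto simp: polys_over_def)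
  qed
  then show ?thesis using Br by (simp add: normal_domain_iff B_def)
qed

section \<open>Integral closure in a simple algebraic extension\<close>

text \<open>
  In an integral equation of least degree the constant term does not vanish, and it is divisible
  by \<open>z\<close>.
\<close>

lemma integral_divides_base:
  fixes A :: "'a::field set"
  assumes A: "is_subring A" and z: "integral_over A z" "z \<noteq> 0"
  shows "\<exists>j\<in>is_subring hull (insert z A). z * j \<in> A \<and> j \<noteq> 0"
proof -
  define Q where "Q n \<longleftrightarrow> (\<exists>a. (\<forall>i<n. a i \<in> A) \<and> z ^ n + (\<Sum>i<n. a i * z ^ i) = 0)" for n
  define n where "n = (LEAST n. Q n)"
  have "\<exists>n. Q n" using z(1) unfolding integral_over_iff[OF A] Q_def by blast
  then have Qn: "Q n" and least: "\<And>m. m < n \<Longrightarrow> \<not> Q m"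
    unfolding n_def by (auto intro: LeastI_ex dest: not_less_Least)
  obtain a where a: "\<And>i. i < n \<Longrightarrow> a i \<in> A" "z ^ n + (\<Sum>i<n. a i * z ^ i) = 0"
    using Qn unfolding Q_def by blast
  have "n \<noteq> 0" using a(2) by (cases n) auto
  then obtain m where n: "n = Suc m" by (cases n) auto
  define j where "j = z ^ m + (\<Sum>i<m. a (Suc i) * z ^ i)"
  have eq: "z * j + a 0 = 0"
    using a(2) unfolding n j_def sum.lessThan_Suc_shift
    by (simp add: distrib_left sum_distrib_left ac_simps)
  have "j \<noteq> 0"
  proof
    assume "j = 0"
    then have "Q m" unfolding Q_def j_def using a(1) n by (intro exI[of _ "\<lambda>i. a (Suc i)"]) auto
    with least[of m] n show False by simp
  qed
  moreover have "z * j = - a 0" using eq by (simp add: eq_neg_iff_add_eq_0)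
  then have "z * j \<in> A" using a(1)[of 0] n subring_uminus[OF A] by simp
  moreover have "j \<in> is_subring hull (insert z A)"
  proof -
    have "z \<in> is_subring hull (insert z A)" "A \<subseteq> is_subring hull (insert z A)"
      using subset_subring_hull by blast+
    then show ?thesis unfolding j_def using a(1) n by (auto intro!: subring_intros is_subring_hull)
  qed
  ultimately show ?thesis by blast
qed

lemma is_subfield_adjoin_integral:
  fixes E :: "'a::field set"
  assumes E: "is_subfield E" and z: "integral_over E z"
  shows "is_subfield (is_subring hull (insert z E))"
  unfolding is_subfield_def
proof (intro conjI ballI)
  define B where "B = is_subring hull (insert z E)"
  have Er: "is_subring E" by (rule subfield_subring[OF E])
  have B: "is_subring B" unfolding B_def by (rule is_subring_hull)
  show "is_subring (is_subring hull (insert z E))" by (rule is_subring_hull)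
  fix x assume "x \<in> is_subring hull (insert z E)"
  then have x: "x \<in> B" by (simp add: B_def)
  have EB: "E \<subseteq> B" unfolding B_def using subset_subring_hull by blast
  have "B \<subseteq> {x. integral_over E x}"
    unfolding B_def using z integral_over_self[OF Er]
    by (intro subring_hull_minimal is_subring_integral_closure Er) auto
  then have "integral_over E x" using x by auto
  show "inverse x \<in> is_subring hull (insert z E)"
  proof (cases "x = 0")
    case True
    then show ?thesis using subring_zero[OF B] by (simp add: B_def)
  next
    case False
    obtain j where j: "j \<in> is_subring hull (insert x E)" "x * j \<in> E" "j \<noteq> 0"
      using integral_divides_base[OF Er \<open>integral_over E x\<close> False] by blast
    have "is_subring hull (insert x E) \<subseteq> B" using x EB by (intro subring_hull_minimal B) auto
    then have "j \<in> B" using j by auto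
    moreover have "inverse (x * j) \<in> B" using E EB j(2) by (auto simp: is_subfield_def)
    ultimately have mem: "j * inverse (x * j) \<in> B" by (intro subring_mult B)
    have "j * inverse (x * j) = inverse x" using j(3) False by (simp add: field_simps)
    then show ?thesis using mem unfolding B_def by (simp only:)
  qed
qed

lemma integral_clear_denominator:
  fixes A :: "'a::field set"
  assumes A: "is_subring A" and z: "integral_over (Frac A) z"
  shows "\<exists>d\<in>A. d \<noteq> 0 \<and> integral_over A (d * z)"
proof -
  have FA: "is_subring (Frac A)" by (rule subfield_subring[OF is_subfield_Frac[OF A]])
  obtain n e where e: "\<And>i. i < n \<Longrightarrow> e i \<in> Frac A" "z ^ n + (\<Sum>i<n. e i * z ^ i) = 0"
    using z unfolding integral_over_iff[OF FA] by blast
  have "\<exists>d\<in>A. d \<noteq> 0 \<and> d * e i \<in> A" if "i < n" for i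
  proof -
    obtain x y where "e i = x / y" "x \<in> A" "y \<in> A" "y \<noteq> 0"
      using e(1)[OF \<open>i < n\<close>] unfolding Frac_def by blast
    then show ?thesis by (intro bexI[of _ y]) auto
  qed
  then obtain d where d: "\<And>i. i < n \<Longrightarrow> d i \<in> A" "\<And>i. i < n \<Longrightarrow> d i \<noteq> 0" "\<And>i. i < n \<Longrightarrow> d i * e i \<in> A"
    by metis
  define D where "D = (\<Prod>i<n. d i)"
  have DA: "D \<in> A" and D0: "D \<noteq> 0" unfolding D_def using d by (auto intro!: subring_prod A)
  have De: "D * e i \<in> A" if "i < n" for i
  proof -
    have "D * e i = (\<Prod>j\<in>{..<n} - {i}. d j) * (d i * e i)"
      using prod.remove[of "{..<n}" i d] that by (simp add: D_def ac_simps)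
    also have "\<dots> \<in> A" using d(1,3) that by (intro subring_mult[OF A subring_prod[OF A]]) auto
    finally show ?thesis .
  qed
  have "(D * z) ^ n + (\<Sum>i<n. (D ^ (n - i) * e i) * (D * z) ^ i) = D ^ n * (z ^ n + (\<Sum>i<n. e i * z ^ i))"
    unfolding distrib_left sum_distrib_left
  proof (intro arg_cong2[of _ _ _ _ "(+)"] sum.cong refl)
    fix i assume "i \<in> {..<n}"
    then have "D ^ n = D ^ (n - i) * D ^ i" by (simp flip: power_add)
    then show "D ^ (n - i) * e i * (D * z) ^ i = D ^ n * (e i * z ^ i)"
      by (simp add: power_mult_distrib ac_simps)
  qed (simp add: power_mult_distrib)
  then have eq: "(D * z) ^ n + (\<Sum>i<n. (D ^ (n - i) * e i) * (D * z) ^ i) = 0" using e(2) by simp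
  moreover have "D ^ (n - i) * e i \<in> A" if i: "i < n" for i
  proof -
    obtain l where "n - i = Suc l" using Suc_diff_Suc[OF i] by metis
    then have "D ^ (n - i) * e i = D ^ l * (D * e i)" by (simp add: ac_simps)
    also have "\<dots> \<in> A" by (intro subring_mult subring_power A DA De i)
    finally show ?thesis .
  qed
  ultimately have "integral_over A (D * z)"
    unfolding integral_over_iff[OF A]
    by (intro exI[of _ n] exI[of _ "\<lambda>i. D ^ (n - i) * e i"]) auto
  then show ?thesis using DA D0 by blast
qed

lemma min_poly_exists:
  fixes E :: "'a::field set"
  assumes E: "is_subfield E" and z: "integral_over E z"
  obtains m where "m \<in> polys_over E" "lead_coeff m = 1" "poly m z = 0"
    "\<And>p. p \<in> polys_over E \<Longrightarrow> p \<noteq> 0 \<Longrightarrow> poly p z = 0 \<Longrightarrow> degree m \<le> degree p"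
    "\<And>p. p \<in> polys_over E \<Longrightarrow> poly p z = 0 \<Longrightarrow> m dvd p"
proof -
  have PE: "is_subring (polys_over E)" by (rule is_subring_polys_over[OF subfield_subring[OF E]])
  define Q where "Q p \<longleftrightarrow> p \<in> polys_over E \<and> p \<noteq> 0 \<and> poly p z = 0" for p
  obtain p0 where "Q p0" using z unfolding integral_over_def Q_def by force
  then obtain m0 where m0: "Q m0" "\<And>p. Q p \<Longrightarrow> degree m0 \<le> degree p"
    using ex_has_least_nat[of Q p0 degree] by blast
  define m where "m = smult (inverse (lead_coeff m0)) m0"
  have m0n: "lead_coeff m0 \<noteq> 0" using m0 by (auto simp: Q_def)
  have degm: "degree m = degree m0" using m0n by (simp add: m_def)
  have inv: "inverse (lead_coeff m0) \<in> E" using m0(1) E by (auto simp: Q_def polys_over_def is_subfield_def)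
  have 1: "m \<in> polys_over E"
    using m0(1) inv subring_mult[OF subfield_subring[OF E]] by (auto simp: m_def Q_def polys_over_def)
  have 2: "lead_coeff m = 1" using m0n by (simp add: m_def)
  have 3: "poly m z = 0" using m0(1) by (simp add: m_def Q_def)
  have 4: "degree m \<le> degree p" if "p \<in> polys_over E" "p \<noteq> 0" "poly p z = 0" for p
    using m0(2)[of p] that by (simp add: Q_def degm)
  have 5: "m dvd p" if p: "p \<in> polys_over E" "poly p z = 0" for p
  proof -
    have "m \<noteq> 0" using 2 by auto
    then obtain d r where dr: "d \<in> polys_over E" "r \<in> polys_over E" "p = m * d + r" "r = 0 \<or> degree r < degree m"
      using polys_over_division[OF E 1 _ p(1)] by blast
    have "poly r z = 0" using p(2) dr(3) 3 by simp
    then have "r = 0" using 4[OF dr(2)] dr(4) by fastforce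
    then show ?thesis using dr(3) by simp
  qed
  show thesis by (rule that[OF 1 2 3 4 5])
qed

interpretation to_ac: field_hom "to_ac :: 'a::field \<Rightarrow> 'a alg_closure"
  by unfold_locales simp_all

interpretation to_ac_poly: map_poly_idom_hom "to_ac :: 'a::field \<Rightarrow> 'a alg_closure" ..

lemma card_roots_if_simple:
  fixes p :: "'a::alg_closed_field poly"
  assumes p: "p \<noteq> 0" and simple: "\<And>z. poly p z = 0 \<Longrightarrow> poly (pderiv p) z \<noteq> 0"
  shows "card {z. poly p z = 0} = degree p"
proof -
  obtain R where R: "size R = degree p" "p = smult (lead_coeff p) (\<Prod>x\<in>#R. [:-x, 1:])"
    using alg_closed_imp_factorization[OF p] by blast
  have "count R x = 1" if "x \<in># R" for x
  proof (rule ccontr)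
    assume "count R x \<noteq> 1"
    with that obtain R' where R': "R = add_mset x R'" "x \<in># R'"
      by (metis count_add_mset count_inI mset_add One_nat_def)
    then obtain R'' where R'': "R' = add_mset x R''" by (metis mset_add)
    define r where "r = smult (lead_coeff p) (\<Prod>x\<in>#R''. [:-x, 1:])"
    define l where "l = [:-x, 1:]"
    have l: "p = l * (l * r)" "poly l x = 0"
      by (subst R(2)) (simp_all add: R' R'' r_def l_def mult_smult_right)
    then have "poly p x = 0 \<and> poly (pderiv p) x = 0" by (simp add: pderiv_mult)
    with simple show False by blast
  qed
  then have "size R = card (set_mset R)"
    by (simp add: size_multiset_overloaded_eq)
  moreover have "set_mset R = {z. poly p z = 0}"
  proof -
    have "poly p z = 0 \<longleftrightarrow> z \<in># R" for z
      by (subst R(2)) (use p in \<open>auto simp: poly_prod_mset prod_mset_zero_iff\<close>)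
    then show ?thesis by auto
  qed
  ultimately show ?thesis using R(1) by simp
qed

text \<open>
  In characteristic zero a minimal polynomial has no multiple roots: the minimal polynomial of a
  common root with the derivative would be a proper factor.
\<close>

lemma min_poly_simple_roots:
  fixes E :: "'a::field_char_0 set"
  assumes E: "is_subfield E" and m: "m \<in> polys_over E" "lead_coeff m = 1" "poly m z = 0"
    and least: "\<And>p. p \<in> polys_over E \<Longrightarrow> p \<noteq> 0 \<Longrightarrow> poly p z = 0 \<Longrightarrow> degree m \<le> degree p"
    and y: "poly (map_poly to_ac m) y = 0"
  shows "poly (pderiv (map_poly to_ac m)) y \<noteq> 0"
proof
  assume y': "poly (pderiv (map_poly to_ac m)) y = 0"
  have PE: "is_subring (polys_over E)" by (rule is_subring_polys_over[OF subfield_subring[OF E]])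
  define Q where "Q p \<longleftrightarrow> p \<in> polys_over E \<and> p \<noteq> 0 \<and> poly (map_poly to_ac p) y = 0" for p
  have m0: "m \<noteq> 0" using m by auto
  have degm: "degree m \<noteq> 0"
  proof
    assume "degree m = 0"
    then obtain c where "m = [:c:]" by (metis degree_eq_zeroE)
    with m show False by simp
  qed
  have pE: "pderiv m \<in> polys_over E"
    using m(1) subring_mult[OF subfield_subring[OF E]] subring_of_nat[OF subfield_subring[OF E]]
    by (auto simp: polys_over_def coeff_pderiv simp del: of_nat_Suc)
  have "pderiv m \<noteq> 0" using degm by (simp add: pderiv_eq_0_iff)
  then have "Q (pderiv m)" using pE y' by (simp add: Q_def to_ac.map_poly_pderiv)
  then obtain g where g: "Q g" "\<And>p. Q p \<Longrightarrow> degree g \<le> degree p"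
    using ex_has_least_nat[of Q "pderiv m" degree] by blast
  have "degree g \<le> degree (pderiv m)" using g(2) \<open>Q (pderiv m)\<close> by blast
  then have dg: "degree g < degree m" using degm by (simp add: degree_pderiv)
  obtain h r where hr: "h \<in> polys_over E" "r \<in> polys_over E" "m = g * h + r" "r = 0 \<or> degree r < degree g"
    using polys_over_division[OF E _ _ m(1), of g] g(1) by (auto simp: Q_def)
  have "poly (map_poly to_ac r) y = 0"
    using y g(1) by (simp add: hr(3) Q_def hom_distribs)
  then have r0: "r = 0" using hr(2,4) g(2)[of r] by (auto simp: Q_def not_le[symmetric])
  have h0: "h \<noteq> 0" "g \<noteq> 0" using m0 hr(3) r0 by auto
  have "degree g \<noteq> 0"
  proof
    assume "degree g = 0"
    then obtain c where c: "g = [:c:]" by (metis degree_eq_zeroE)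
    with g(1) show False by (auto simp: Q_def)
  qed
  moreover have "degree m = degree g + degree h" using hr(3) r0 h0 degree_mult_eq[of g h] by simp
  ultimately have dh: "degree h < degree m" by simp
  have "poly g z = 0 \<or> poly h z = 0" using m(3) hr(3) r0 by simp
  then show False using least[of g] least[of h] g(1) hr(1) h0 dg dh by (auto simp: Q_def)
qed

text \<open>
  Let \<open>\<Delta>\<close> be the product of all differences of conjugates of \<open>z\<close>. If \<open>g(z)\<close> is integral over
  \<open>A\<close>, so are its conjugates \<open>g(y)\<close>, and by Lagrange interpolation at the conjugates \<open>y\<close> of
  \<open>z\<close> the coefficients of \<open>\<Delta> g\<close> are integral. A nonzero multiple \<open>d\<close> of \<open>\<Delta>\<close> by an integral
  element lies in \<open>A\<close>; then \<open>d g\<close> has integral coefficients in \<open>Frac A\<close>, that is, coefficients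
  in \<open>A\<close>.
\<close>

lemma integral_closure_common_denominator:
  fixes A :: "'a::field_char_0 set"
  assumes nA: "normal_domain A" and z: "integral_over A z"
  shows "\<exists>d\<in>A. d \<noteq> 0 \<and> (\<forall>c\<in>is_subring hull (insert z (Frac A)). integral_over A c \<longrightarrow>
    d * c \<in> is_subring hull (insert z A))"
proof -
  have A: "is_subring A" using nA by (simp add: normal_domain_iff)
  define E where "E = Frac A"
  have E: "is_subfield E" unfolding E_def by (rule is_subfield_Frac[OF A])
  have Er: "is_subring E" by (rule subfield_subring[OF E])
  have AE: "A \<subseteq> E" unfolding E_def by (rule subset_Frac[OF A])
  have PE: "is_subring (polys_over E)" by (rule is_subring_polys_over[OF Er])
  obtain m where m: "m \<in> polys_over E" "lead_coeff m = 1" "poly m z = 0"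
    and least: "\<And>p. p \<in> polys_over E \<Longrightarrow> p \<noteq> 0 \<Longrightarrow> poly p z = 0 \<Longrightarrow> degree m \<le> degree p"
    and mdvd: "\<And>p. p \<in> polys_over E \<Longrightarrow> poly p z = 0 \<Longrightarrow> m dvd p"
    using min_poly_exists[OF E integral_over_mono[OF AE z]] by metis
  have m0: "m \<noteq> 0" using m by auto
  define Z where "Z = {y. poly (map_poly to_ac m) y = 0}"
  have mm0: "map_poly to_ac m \<noteq> 0" using m0 by simp
  have finZ: "finite Z" unfolding Z_def by (rule poly_roots_finite[OF mm0])
  have cardZ: "card Z = degree m"
  proof -
    have "poly (pderiv (map_poly to_ac m)) y \<noteq> 0" if "poly (map_poly to_ac m) y = 0" for y
      by (rule min_poly_simple_roots[OF E m _ that]) (rule least)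
    then show ?thesis unfolding Z_def by (subst card_roots_if_simple[OF mm0]) auto
  qed
  define A' where "A' = to_ac ` A"
  have A': "is_subring A'" unfolding A'_def by (rule to_ac.is_subring_image[OF A])
  define J where "J = {x. integral_over A' x}"
  have J: "is_subring J" unfolding J_def by (rule is_subring_integral_closure[OF A'])
  have PJ: "is_subring (polys_over J)" by (rule is_subring_polys_over[OF J])
  have A'J: "A' \<subseteq> J" using integral_over_self[OF A'] by (auto simp: J_def)
  have conj: "poly (map_poly to_ac g) y \<in> J"
    if g: "g \<in> polys_over E" "integral_over A (poly g z)" and y: "y \<in> Z" for g y
  proof -
    obtain n a where a: "\<And>i. i < n \<Longrightarrow> a i \<in> A" "poly g z ^ n + (\<Sum>i<n. a i * poly g z ^ i) = 0"
      using g(2) unfolding integral_over_iff[OF A] by blast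
    define w where "w = g ^ n + (\<Sum>i<n. [:a i:] * g ^ i)"
    have "w \<in> polys_over E"
      unfolding w_def using g a(1) AE by (intro subring_intros PE polys_over_const Er) auto
    moreover have "poly w z = 0" using a(2) by (simp add: w_def poly_sum)
    ultimately have "m dvd w" by (rule mdvd)
    then obtain u where u: "w = m * u" by (elim dvdE)
    have "poly (map_poly to_ac w) y = 0" using y by (simp add: u Z_def hom_distribs)
    then have "poly (map_poly to_ac g) y ^ n + (\<Sum>i<n. to_ac (a i) * poly (map_poly to_ac g) y ^ i) = 0"
      by (simp add: w_def hom_distribs poly_sum)
    then have "integral_over A' (poly (map_poly to_ac g) y)"
      unfolding integral_over_iff[OF A'] using a(1)
      by (intro exI[of _ n] exI[of _ "\<lambda>i. to_ac (a i)"]) (auto simp: A'_def)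
    then show ?thesis by (simp add: J_def)
  qed
  have ZJ: "y \<in> J" if "y \<in> Z" for y
    using conj[OF polys_over_X[OF Er] _ that] z by (simp add: map_poly_pCons)
  (* l y / dz y are the Lagrange basis polynomials for the set Z of conjugates of z. *)
  define dz where "dz y = (\<Prod>x\<in>Z - {y}. y - x)" for y
  define \<Delta> where "\<Delta> = (\<Prod>y\<in>Z. dz y)"
  have dzJ: "dz y \<in> J" if "y \<in> Z" for y
    unfolding dz_def using that ZJ by (intro subring_prod J subring_diff) auto
  have dz0: "dz y \<noteq> 0" for y unfolding dz_def using finZ by (auto simp: prod_zero_iff)
  have \<Delta>: "\<Delta> \<in> J" "\<Delta> \<noteq> 0"
    unfolding \<Delta>_def using dzJ dz0 finZ by (auto intro!: subring_prod J)
  define l where "l y = (\<Prod>x\<in>Z - {y}. [:- x, 1:])" for y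
  have ply: "poly (l y) x = (if x = y then dz y else 0)" if "x \<in> Z" for x y
    using that finZ by (auto simp: l_def dz_def poly_prod prod_zero_iff)
  have degl: "degree (l y) < card Z" if "y \<in> Z" for y
  proof -
    have "degree (l y) \<le> (\<Sum>x\<in>Z - {y}. degree [:- x, 1:])"
      unfolding l_def using degree_prod_sum_le[of "Z - {y}" "\<lambda>x. [:- x, 1:]"] finZ by (simp add: comp_def)
    also have "\<dots> = card (Z - {y})" by simp
    also have "\<dots> < card Z" using finZ that by (rule card_Diff1_less)
    finally show ?thesis .
  qed
  have lJ: "l y \<in> polys_over J" for y
    unfolding l_def
    by (intro subring_prod PJ) (auto simp: polys_over_def coeff_pCons subring_intros J ZJ split: nat.split)
  have interp: "smult \<Delta> (map_poly to_ac g) \<in> polys_over J"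
    if g: "g \<in> polys_over E" "integral_over A (poly g z)" "degree g < degree m" for g
  proof -
    define g' where "g' = map_poly to_ac g"
    define q where "q = (\<Sum>y\<in>Z. smult (poly g' y * (\<Prod>x\<in>Z - {y}. dz x)) (l y))"
    have "smult \<Delta> g' = q"
    proof (rule poly_eqI_degree)
      fix x assume x: "x \<in> Z"
      have "poly q x = (\<Sum>y\<in>Z. if x = y then poly g' y * ((\<Prod>w\<in>Z - {y}. dz w) * dz y) else 0)"
        unfolding q_def poly_sum by (rule sum.cong) (auto simp: ply[OF x])
      also have "\<dots> = poly g' x * ((\<Prod>w\<in>Z - {x}. dz w) * dz x)" using x finZ by simp
      also have "(\<Prod>w\<in>Z - {x}. dz w) * dz x = \<Delta>"
        unfolding \<Delta>_def using prod.remove[OF finZ x, of dz] by (simp add: mult.commute)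
      finally show "poly (smult \<Delta> g') x = poly q x" by simp
    next
      show "degree (smult \<Delta> g') < card Z" using g(3) by (simp add: cardZ g'_def)
      have "0 < card Z" using cardZ g(3) by simp
      then show "degree q < card Z"
        unfolding q_def using finZ degl
        by (intro degree_sum_less) (auto intro: le_less_trans[OF degree_smult_le])
    qed
    moreover have "q \<in> polys_over J"
    proof -
      have "smult (poly g' y * (\<Prod>x\<in>Z - {y}. dz x)) (l y) \<in> polys_over J" if y: "y \<in> Z" for y
      proof -
        have "poly g' y * (\<Prod>x\<in>Z - {y}. dz x) \<in> J"
          unfolding g'_def using conj[OF g(1,2) y] dzJ by (intro subring_mult subring_prod J) auto
        then show ?thesis using subring_mult[OF PJ polys_over_const[OF J] lJ[of y]] by simp
      qed
      then show ?thesis unfolding q_def by (intro subring_sum PJ)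
    qed
    ultimately show ?thesis by (simp add: g'_def)
  qed
  (* Passing to the multiple d in A replaces the symmetric function argument for the discriminant. *)
  obtain j where j: "j \<in> is_subring hull (insert \<Delta> A')" "\<Delta> * j \<in> A'" "j \<noteq> 0"
    using integral_divides_base[OF A' _ \<Delta>(2)] \<Delta>(1) by (auto simp: J_def)
  have jJ: "j \<in> J" using j(1) subring_hull_minimal[OF J, of "insert \<Delta> A'"] \<Delta>(1) A'J by auto
  obtain d where d: "d \<in> A" "\<Delta> * j = to_ac d" using j(2) by (auto simp: A'_def)
  have d0: "d \<noteq> 0" using d(2) j(3) \<Delta>(2) by auto
  have "d * c \<in> is_subring hull (insert z A)"
    if c: "c \<in> is_subring hull (insert z E)" "integral_over A c" for c
  proof -
    obtain p where p: "p \<in> polys_over E" "c = poly p z" using c(1) subring_hull_insert_eq[OF Er] by auto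
    obtain u g where g: "u \<in> polys_over E" "g \<in> polys_over E" "p = m * u + g" "g = 0 \<or> degree g < degree m"
      using polys_over_division[OF E m(1) m0 p(1)] by blast
    have cg: "c = poly g z" using p(2) g(3) m(3) by simp
    have "degree m \<noteq> 0"
    proof
      assume "degree m = 0"
      then obtain c where "m = [:c:]" by (metis degree_eq_zeroE)
      with m show False by simp
    qed
    then have "degree g < degree m" using g(4) by auto
    then have *: "smult \<Delta> (map_poly to_ac g) \<in> polys_over J" using interp[OF g(2)] c(2) cg by simp
    have "d * coeff g i \<in> A" for i
    proof -
      have "to_ac (d * coeff g i) = j * coeff (smult \<Delta> (map_poly to_ac g)) i"
        by (simp add: hom_distribs d(2)[symmetric] ac_simps)
      also have "\<dots> \<in> J" by (rule subring_mult[OF J jJ polys_overD[OF *]])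
      finally have "integral_over A (d * coeff g i)"
        by (simp add: J_def A'_def to_ac.integral_over_image_iff[OF A] del: to_ac_mult)
      moreover have "d * coeff g i \<in> E"
        using d(1) AE g(2) by (intro subring_mult[OF Er]) (auto simp: polys_over_def)
      ultimately show ?thesis using nA by (auto simp: normal_domain_iff E_def)
    qed
    then have "smult d g \<in> polys_over A" by (simp add: polys_over_def)
    moreover have "d * c = poly (smult d g) z" by (simp add: cg)
    ultimately show ?thesis unfolding subring_hull_insert_eq[OF A] by blast
  qed
  then show ?thesis using d(1) d0 unfolding E_def by blast
qed

text \<open>
  A common denominator \<open>d\<close> turns the integral closure \<open>C\<close> into an ideal \<open>d C\<close> of the Noetherian
  ring \<open>A[z]\<close>.
\<close>

lemma affine_normal_integral_closure:
  fixes A k :: "'a::field_char_0 set"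
  assumes k: "is_subfield k" and aA: "affine_domain k A" and nA: "normal_domain A"
    and \<alpha>: "integral_over (Frac A) \<alpha>"
  defines "C \<equiv> {c \<in> Frac (is_subring hull (insert \<alpha> A)). integral_over A c}"
  shows "affine_domain k C" "normal_domain C"
proof -
  have A: "is_subring A" using nA by (simp add: normal_domain_iff)
  define E where "E = Frac A"
  have E: "is_subfield E" unfolding E_def by (rule is_subfield_Frac[OF A])
  have Er: "is_subring E" by (rule subfield_subring[OF E])
  have AE: "A \<subseteq> E" unfolding E_def by (rule subset_Frac[OF A])
  define F where "F = Frac (is_subring hull (insert \<alpha> A))"
  have F: "is_subfield F" unfolding F_def by (intro is_subfield_Frac is_subring_hull)
  have Fr: "is_subring F" by (rule subfield_subring[OF F])
  have hullF: "is_subring hull (insert \<alpha> A) \<subseteq> F" unfolding F_def by (intro subset_Frac is_subring_hull)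
  then have AF: "A \<subseteq> F" and \<alpha>F: "\<alpha> \<in> F" using subset_subring_hull[of "insert \<alpha> A"] by blast+
  have EF: "E \<subseteq> F" unfolding E_def by (rule Frac_minimal[OF F AF])
  have C: "C = F \<inter> {c. integral_over A c}" by (auto simp: C_def F_def)
  have Cr: "is_subring C"
    unfolding C using Fr is_subring_integral_closure[OF A] by (auto simp: is_subring_def)
  have AC: "A \<subseteq> C" unfolding C using AF integral_over_self[OF A] by auto
  show "normal_domain C"
    unfolding normal_domain_iff
  proof (intro conjI ballI impI Cr)
    fix x assume x: "x \<in> Frac C" "integral_over C x"
    have "x \<in> F" using x(1) Frac_minimal[OF F, of C] C by auto
    moreover have "integral_over {c. integral_over A c} x"
      by (rule integral_over_mono[OF _ x(2)]) (auto simp: C)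
    then have "integral_over A x" by (rule integral_over_trans[OF A])
    ultimately show "x \<in> C" by (simp add: C)
  qed
  (* An integral generator of the same field extension. *)
  obtain a where a: "a \<in> A" "a \<noteq> 0" "integral_over A (a * \<alpha>)"
    using integral_clear_denominator[OF A \<alpha>] by blast
  define z where "z = a * \<alpha>"
  have zint: "integral_over A z" using a(3) by (simp add: z_def)
  have zC: "z \<in> C" using a AF \<alpha>F subring_mult[OF Fr] by (auto simp: C z_def)
  have "is_subfield (is_subring hull (insert z E))"
    by (rule is_subfield_adjoin_integral[OF E integral_over_mono[OF AE zint]])
  moreover have "is_subring hull (insert \<alpha> A) \<subseteq> is_subring hull (insert z E)"
  proof (intro subring_hull_minimal is_subring_hull)
    have sub: "insert z E \<subseteq> is_subring hull (insert z E)" by (rule subset_subring_hull)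
    have "inverse a \<in> E" using a(1) AE E by (auto simp: is_subfield_def)
    then have "inverse a * z \<in> is_subring hull (insert z E)"
      using sub by (intro subring_mult is_subring_hull) auto
    moreover have "inverse a * z = \<alpha>" using a(2) by (simp add: z_def)
    ultimately show "insert \<alpha> A \<subseteq> is_subring hull (insert z E)" using sub AE by auto
  qed
  ultimately have FE: "F \<subseteq> is_subring hull (insert z E)" unfolding F_def by (rule Frac_minimal)
  define B where "B = is_subring hull (insert z A)"
  have Br: "is_subring B" unfolding B_def by (rule is_subring_hull)
  have BC: "B \<subseteq> C" unfolding B_def using zC AC by (intro subring_hull_minimal Cr) auto
  obtain d where d: "d \<in> A" "d \<noteq> 0" "\<And>c. c \<in> C \<Longrightarrow> d * c \<in> B"
    using integral_closure_common_denominator[OF nA zint] FE C unfolding B_def E_def by blast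
  obtain S where S: "finite S" "A = is_subring hull (k \<union> S)" and kA: "k \<subseteq> A"
    using aA by (auto simp: affine_domain_def)
  have BS: "B = is_subring hull (k \<union> insert z S)"
    unfolding B_def S(2) subring_hull_Un_insert by simp
  have kB: "k \<subseteq> B" unfolding BS using subset_subring_hull by blast
  have "affine_domain k B"
    unfolding affine_domain_def using Br kB BS S(1) by blast
  then have "noetherian B" by (rule noetherian_affine_domain[OF k])
  moreover have "is_ideal B ((*) d ` C)"
    unfolding is_ideal_def is_submodule_def
  proof (intro conjI ballI)
    show "(*) d ` C \<subseteq> B" using d(3) by auto
    show "0 \<in> (*) d ` C" using subring_zero[OF Cr] by (intro image_eqI[of _ _ 0]) auto
    fix x y assume "x \<in> (*) d ` C" "y \<in> (*) d ` C"
    then show "x + y \<in> (*) d ` C" using subring_add[OF Cr] by (auto simp flip: distrib_left)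
  next
    fix b x assume "b \<in> B" "x \<in> (*) d ` C"
    then obtain c where "c \<in> C" "x = d * c" by auto
    then show "b * x \<in> (*) d ` C"
      using \<open>b \<in> B\<close> BC subring_mult[OF Cr, of b c] by (intro image_eqI[of _ _ "b * c"]) auto
  qed
  ultimately obtain G where G: "finite G" "(*) d ` C = lspan B G" unfolding noetherian_def by blast
  define T where "T = insert z S \<union> (\<lambda>g. g / d) ` G"
  have finT: "finite T" using S(1) G(1) by (simp add: T_def)
  define H where "H = is_subring hull (k \<union> T)"
  have Hr: "is_subring H" unfolding H_def by (rule is_subring_hull)
  have BH: "B \<subseteq> H" unfolding BS H_def T_def by (rule hull_mono) auto
  have GH: "g / d \<in> H" if "g \<in> G" for g
    using that subset_subring_hull[of "k \<union> T"] by (auto simp: H_def T_def)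
  have "C = H"
  proof (intro equalityI subsetI)
    fix c assume "c \<in> C"
    then have "d * c \<in> lspan B G" using G(2) by blast
    then obtain b where b: "d * c = (\<Sum>g\<in>G. b g * g)" "\<forall>g. b g \<in> B" unfolding lspan_def by blast
    have "c = (\<Sum>g\<in>G. b g * (g / d))"
      using arg_cong[OF b(1), of "\<lambda>x. x / d"] d(2) by (simp add: sum_divide_distrib)
    also have "\<dots> \<in> H" using b(2) BH GH by (intro subring_sum subring_mult Hr) auto
    finally show "c \<in> H" .
  next
    have "(\<lambda>g. g / d) ` G \<subseteq> C"
    proof clarify
      fix g assume "g \<in> G"
      then have "g \<in> (*) d ` C" using lspan_inc[OF Br G(1)] G(2) by auto
      then show "g / d \<in> C" using d(2) by auto
    qed
    moreover have "k \<union> insert z S \<subseteq> C"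
      using kB BC subset_subring_hull[of "k \<union> insert z S"] unfolding BS by auto
    ultimately have "H \<subseteq> C" unfolding H_def T_def by (intro subring_hull_minimal Cr) auto
    then show "c \<in> C" if "c \<in> H" for c using that by auto
  qed
  then show "affine_domain k C"
    unfolding affine_domain_def using Cr kA AC finT by (auto simp: H_def)
qed

instance fract :: ("{idom, ring_char_0}") field_char_0
proof
  show "inj (of_nat :: nat \<Rightarrow> 'a fract)"
    by (rule injI) (simp add: of_nat_fract eq_fract)
qed

section \<open>Units and locally nilpotent derivations\<close>

lemma derivation_on_zero:
  fixes B :: "'a::field set"
  assumes B: "is_subring B" and D: "derivation_on B D"
  shows "D 0 = 0"
proof -
  have "D (0 + 0) = D 0 + D 0" using D subring_zero[OF B] unfolding derivation_on_def by blast
  then have "D 0 + 0 = D 0 + D 0" by simp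
  then show ?thesis by (simp only: add_left_cancel)
qed

lemma LND_funpow:
  fixes B :: "'a::field set"
  assumes B: "is_subring B" and D: "derivation_on B D"
  shows "x \<in> B \<Longrightarrow> (D ^^ n) x \<in> B" "(D ^^ n) 0 = 0"
  using D derivation_on_zero[OF B D] by (induction n) (auto simp: derivation_on_def Pi_def PiE_def)

lemma derivation_on_sum:
  fixes B :: "'a::field set"
  assumes B: "is_subring B" and D: "derivation_on B D" and f: "\<And>i. i \<in> I \<Longrightarrow> f i \<in> B"
  shows "D (sum f I) = (\<Sum>i\<in>I. D (f i))"
  using f
proof (induction I rule: infinite_finite_induct)
  case (insert i I)
  then show ?case using D subring_sum[OF B, of I f] by (simp add: derivation_on_def)
qed (simp_all add: derivation_on_zero[OF B D])

lemma derivation_leibniz_power: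
  fixes B :: "'a::field set"
  assumes B: "is_subring B" and D: "derivation_on B D" and xy: "x \<in> B" "y \<in> B"
  shows "(D ^^ n) (x * y) = (\<Sum>i\<le>n. of_nat (n choose i) * (D ^^ i) x * (D ^^ (n - i)) y)"
proof (induction n)
  case (Suc n)
  have DB: "(D ^^ i) x \<in> B" "(D ^^ i) y \<in> B" for i using LND_funpow[OF B D] xy by auto
  have prod: "D (a * b) = D a * b + a * D b" if "a \<in> B" "b \<in> B" for a b
    using D that by (simp add: derivation_on_def)
  have Dnat: "D (of_nat m * a) = of_nat m * D a" if "a \<in> B" for m a
    using derivation_on_sum[OF B D, of "{..<m}" "\<lambda>_. a"] that by simp
  define u where "u i = (D ^^ i) x" for i
  define v where "v i = (D ^^ i) y" for i
  have uv: "u i \<in> B" "v i \<in> B" for i using DB by (auto simp: u_def v_def)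
  have step: "D (of_nat c * u i * v j) = of_nat c * u (Suc i) * v j + of_nat c * u i * v (Suc j)" for c i j
    using Dnat[of "u i * v j" c] prod[of "u i" "v j"] uv subring_mult[OF B]
    by (simp add: mult.assoc distrib_left) (simp add: u_def v_def)
  have "(D ^^ Suc n) (x * y) = D (\<Sum>i\<le>n. of_nat (n choose i) * u i * v (n - i))"
    using Suc by (simp add: u_def v_def)
  also have "\<dots> = (\<Sum>i\<le>n. D (of_nat (n choose i) * u i * v (n - i)))"
    using uv by (intro derivation_on_sum[OF B D] subring_mult[OF B] subring_of_nat[OF B])
  also have "\<dots> = (\<Sum>i\<le>n. of_nat (n choose i) * u (Suc i) * v (n - i)) + (\<Sum>i\<le>n. of_nat (n choose i) * u i * v (Suc n - i))"
    unfolding step sum.distrib by (intro arg_cong2[of _ _ _ _ "(+)"] sum.cong refl) (simp add: Suc_diff_le)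
  also have "(\<Sum>i\<le>n. of_nat (n choose i) * u i * v (Suc n - i))
      = (\<Sum>i\<le>Suc n. of_nat (n choose i) * u i * v (Suc n - i))"
    by (simp add: binomial_eq_0)
  also have "\<dots> = u 0 * v (Suc n) + (\<Sum>i\<le>n. of_nat (n choose Suc i) * u (Suc i) * v (n - i))"
    by (subst sum.atMost_Suc_shift) simp
  also have "(\<Sum>i\<le>n. of_nat (n choose i) * u (Suc i) * v (n - i)) + \<dots>
      = u 0 * v (Suc n) + (\<Sum>i\<le>n. of_nat (Suc n choose Suc i) * u (Suc i) * v (n - i))"
    by (simp add: distrib_right sum.distrib)
  also have "\<dots> = (\<Sum>i\<le>Suc n. of_nat (Suc n choose i) * u i * v (Suc n - i))"
    by (subst sum.atMost_Suc_shift) (simp del: binomial_Suc_Suc)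
  finally show ?case by (simp only: u_def v_def)
qed simp

text \<open>
  If \<open>D\<^sup>m x\<close> and \<open>D\<^sup>n y\<close> are the last nonzero iterates, then \<open>D\<^bsup>m+n\<^esup>(x y)\<close> is a nonzero
  multiple of their product; \<open>x y = 1\<close> forces \<open>m + n = 0\<close>.
\<close>

lemma LND_unit:
  fixes B :: "'a::field_char_0 set"
  assumes B: "is_subring B" and D: "D \<in> LND B" and x: "x \<in> B" "x \<noteq> 0" "inverse x \<in> B"
  shows "D x = 0"
proof -
  have der: "derivation_on B D" using D by (simp add: LND_def)
  have last: "\<exists>m. (D ^^ m) x \<noteq> 0 \<and> (\<forall>i>m. (D ^^ i) x = 0)" if x: "x \<in> B" "x \<noteq> 0" for x
  proof -
    define n where "n = (LEAST n. (D ^^ n) x = 0)"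
    obtain n0 where "(D ^^ n0) x = 0" using D x by (auto simp: LND_def)
    then have n: "(D ^^ n) x = 0" unfolding n_def by (rule LeastI)
    then have "n \<noteq> 0" using x by (intro notI) simp
    then obtain m where m: "n = Suc m" by (cases n) auto
    have "(D ^^ m) x \<noteq> 0" using not_less_Least[of m "\<lambda>n. (D ^^ n) x = 0"] m by (auto simp: n_def)
    moreover have "(D ^^ i) x = 0" if "i > m" for i
    proof -
      have "i = (i - n) + n" using that m by simp
      then have "(D ^^ i) x = (D ^^ (i - n)) ((D ^^ n) x)" by (metis funpow_add comp_apply)
      then show ?thesis using n LND_funpow(2)[OF B der] by simp
    qed
    ultimately show ?thesis by blast
  qed
  define y where "y = inverse x"
  have y: "y \<in> B" "y \<noteq> 0" "x * y = 1" using x by (auto simp: y_def)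
  obtain m where m: "(D ^^ m) x \<noteq> 0" "\<And>i. i > m \<Longrightarrow> (D ^^ i) x = 0" using last[OF x(1,2)] by blast
  obtain n where n: "(D ^^ n) y \<noteq> 0" "\<And>i. i > n \<Longrightarrow> (D ^^ i) y = 0" using last[OF y(1,2)] by blast
  have "(D ^^ (m + n)) (x * y) = (\<Sum>i\<le>m + n. of_nat (m + n choose i) * (D ^^ i) x * (D ^^ (m + n - i)) y)"
    by (rule derivation_leibniz_power[OF B der x(1) y(1)])
  also have "\<dots> = (\<Sum>i\<le>m + n. if i = m then of_nat (m + n choose m) * (D ^^ m) x * (D ^^ n) y else 0)"
  proof (rule sum.cong[OF refl])
    fix i
    consider "i = m" | "i > m" | "m + n - i > n" by linarith
    then show "of_nat (m + n choose i) * (D ^^ i) x * (D ^^ (m + n - i)) y =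
        (if i = m then of_nat (m + n choose m) * (D ^^ m) x * (D ^^ n) y else 0)"
      using m(2) n(2) by cases auto
  qed
  also have "\<dots> = of_nat (m + n choose m) * (D ^^ m) x * (D ^^ n) y" by simp
  also have "\<dots> \<noteq> 0" using m n by simp
  finally have nz: "(D ^^ (m + n)) 1 \<noteq> 0" by (simp add: y(3))
  have "D (1 * 1) = D 1 * 1 + 1 * D 1" using der subring_one[OF B] unfolding derivation_on_def by blast
  then have "D 1 = 0" by simp
  then have "(D ^^ Suc i) 1 = 0" for i
    using LND_funpow(2)[OF B der, of i] by (simp add: funpow_Suc_right del: funpow.simps)
  then have "m + n = 0" using nz by (cases "m + n") auto
  then show ?thesis using m(2)[of 1] by simp
qed

section \<open>Two locally nilpotent derivations on a ring of bihomogeneous forms\<close>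

interpretation to_fract: inj_idom_hom "to_fract :: 'a::idom \<Rightarrow> 'a fract"
  by unfold_locales simp_all

lemma Fract_eq_divide: "Fract a b = to_fract a / to_fract b"
  by (simp add: to_fract_def)

lemma ratfun2_const_eq: "ratfun2_const c = to_fract [:[:c:]:]"
  by (simp add: ratfun2_const_def to_fract_def)

lemma (in comm_ring_hom) image_subring_hull:
  "hom ` (is_subring hull S) = is_subring hull (hom ` S)"
proof (intro equalityI)
  show "is_subring hull (hom ` S) \<subseteq> hom ` (is_subring hull S)"
    by (intro subring_hull_minimal is_subring_image is_subring_hull image_mono subset_subring_hull)
  have "is_subring {x. hom x \<in> is_subring hull (hom ` S)}"
    using is_subring_hull[of "hom ` S"] unfolding is_subring_def by (simp add: hom_distribs)
  moreover have "S \<subseteq> {x. hom x \<in> is_subring hull (hom ` S)}"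
    using subset_subring_hull[of "hom ` S"] by auto
  ultimately have "is_subring hull S \<subseteq> {x. hom x \<in> is_subring hull (hom ` S)}"
    by (intro subring_hull_minimal)
  then show "hom ` (is_subring hull S) \<subseteq> is_subring hull (hom ` S)" by auto
qed

text \<open>
  The operator on the image of \<open>B\<close> in the field of fractions that corresponds to \<open>d\<close>; outside the
  image it is \<open>undefined\<close>, as \<open>derivation_on\<close> demands.
\<close>

definition lift_to_fract :: "('a::idom) set \<Rightarrow> ('a \<Rightarrow> 'a) \<Rightarrow> 'a fract \<Rightarrow> 'a fract" where
  "lift_to_fract B d = restrict (\<lambda>b. to_fract (d (inv_into UNIV to_fract b))) (to_fract ` B)"

lemma lift_to_fract: "f \<in> B \<Longrightarrow> lift_to_fract B d (to_fract f) = to_fract (d f)"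
  by (simp add: lift_to_fract_def)

lemma lift_to_fract_LND:
  assumes d: "\<And>f. f \<in> B \<Longrightarrow> d f \<in> B" "\<And>f g. d (f + g) = d f + d g" "\<And>f g. d (f * g) = d f * g + f * d g"
    and nil: "\<And>f. f \<in> B \<Longrightarrow> \<exists>n. (d ^^ n) f = 0" and B: "is_subring B"
  shows "lift_to_fract B d \<in> LND (to_fract ` B)"
proof -
  define D where "D = lift_to_fract B d"
  have D: "D (to_fract f) = to_fract (d f)" if "f \<in> B" for f using lift_to_fract[OF that] by (simp add: D_def)
  have "derivation_on (to_fract ` B) D"
    unfolding derivation_on_def
  proof (intro conjI ballI)
    show "D \<in> to_fract ` B \<rightarrow>\<^sub>E to_fract ` B"
      using d(1) by (auto simp: D_def lift_to_fract_def)
    fix x y assume "x \<in> to_fract ` B" "y \<in> to_fract ` B"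
    then obtain f g where fg: "f \<in> B" "g \<in> B" "x = to_fract f" "y = to_fract g" by auto
    show "D (x + y) = D x + D y"
      using fg D[OF subring_add[OF B fg(1,2)]] D[OF fg(1)] D[OF fg(2)] d(2) by simp
    show "D (x * y) = D x * y + x * D y"
      using fg D[OF subring_mult[OF B fg(1,2)]] D[OF fg(1)] D[OF fg(2)] d(3) by simp
  qed
  moreover have "\<exists>n. (D ^^ n) x = 0" if x: "x \<in> to_fract ` B" for x
  proof -
    obtain f where f: "f \<in> B" "x = to_fract f" using x by blast
    have "(d ^^ n) f \<in> B \<and> (D ^^ n) x = to_fract ((d ^^ n) f)" for n
      by (induction n) (auto simp: f D d(1))
    then show ?thesis using nil[OF f(1)] by (metis to_fract_0)
  qed
  ultimately show ?thesis by (auto simp: LND_def D_def)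
qed

lemma ker_lift_to_fract:
  "ker_on (to_fract ` B) (lift_to_fract B d) = to_fract ` {f \<in> B. d f = 0}"
  by (auto simp: ker_on_def lift_to_fract)

text \<open>
  With \<open>X\<close> the inner and \<open>Y\<close> the outer variable, this is the ring of all \<open>f(X, Y)\<close> such that
  \<open>f(T, T Z)\<close> is a polynomial in \<open>Z\<close> over \<open>R\<close>. For a graded \<open>R\<close> the condition says that
  \<open>c T\<^bsup>i+j\<^esup> \<in> R\<close> for each term \<open>c X\<^sup>i Y\<^sup>j\<close> of \<open>f\<close>.
\<close>

definition bihomogeneous :: "'a::field poly set \<Rightarrow> 'a poly poly set" where
  "bihomogeneous R = {f. \<forall>j. monom 1 j * coeff f j \<in> R}"

definition Y_dX :: "'a::field poly poly \<Rightarrow> 'a poly poly" where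
  "Y_dX f = monom 1 1 * map_poly pderiv f"

definition X_dY :: "'a::field poly poly \<Rightarrow> 'a poly poly" where
  "X_dY f = smult (monom 1 1) (pderiv f)"

lemma coeff_Y_dX: "coeff (Y_dX f) j = (case j of 0 \<Rightarrow> 0 | Suc i \<Rightarrow> pderiv (coeff f i))"
  by (simp add: Y_dX_def coeff_monom_mult coeff_map_poly split: nat.split)

lemma coeff_X_dY: "coeff (X_dY f) j = monom 1 1 * (of_nat (Suc j) * coeff f (Suc j))"
  by (simp add: X_dY_def coeff_pderiv)

lemma Y_dX_add: "Y_dX (f + g) = Y_dX f + Y_dX g"
  by (rule poly_eqI) (simp add: coeff_Y_dX pderiv_add split: nat.split)

lemma X_dY_add: "X_dY (f + g) = X_dY f + X_dY g"
  by (simp add: X_dY_def pderiv_add smult_add_right)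

lemma X_dY_mult: "X_dY (f * g) = X_dY f * g + f * X_dY g"
  by (simp add: X_dY_def pderiv_mult smult_add_right mult.commute)

lemma Y_dX_mult: "Y_dX (f * g) = Y_dX f * g + f * Y_dX g"
proof -
  have "map_poly pderiv (f * g) = map_poly pderiv f * g + f * map_poly pderiv g"
    by (rule poly_eqI, simp only: coeff_map_poly[where f = pderiv, OF pderiv_0] coeff_add coeff_mult pderiv_sum
        pderiv_mult sum.distrib) (simp add: mult.commute add.commute)
  then show ?thesis by (simp add: Y_dX_def algebra_simps)
qed

lemma Y_dX_nilpotent: "\<exists>n. (Y_dX ^^ n) f = 0"
proof -
  have *: "(Y_dX ^^ n) f = 0" if "\<And>i j. i \<ge> n \<Longrightarrow> coeff (coeff f j) i = 0" for n and f :: "'a poly poly"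
    using that
  proof (induction n arbitrary: f)
    case 0
    then show ?case by (auto intro!: poly_eqI)
  next
    case (Suc n)
    have "coeff (coeff (Y_dX f) j) i = 0" if "i \<ge> n" for i j
      using Suc.prems that by (auto simp: coeff_Y_dX coeff_pderiv split: nat.split)
    then have "(Y_dX ^^ n) (Y_dX f) = 0" by (rule Suc.IH)
    then show ?case by (simp add: funpow_Suc_right del: funpow.simps)
  qed
  define n where "n = Suc (\<Sum>j\<le>degree f. degree (coeff f j))"
  have "coeff (coeff f j) i = 0" if "i \<ge> n" for i j
  proof (cases "j \<le> degree f")
    case True
    then have "degree (coeff f j) \<le> (\<Sum>j\<le>degree f. degree (coeff f j))"
      by (intro member_le_sum) auto
    then show ?thesis using that by (intro coeff_eq_0) (simp add: n_def)
  qed (simp add: coeff_eq_0)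
  then show ?thesis using * by blast
qed

lemma X_dY_nilpotent: "\<exists>n. (X_dY ^^ n) f = 0"
proof -
  have *: "(X_dY ^^ n) f = 0" if "\<And>j. j \<ge> n \<Longrightarrow> coeff f j = 0" for n and f :: "'a poly poly"
    using that
  proof (induction n arbitrary: f)
    case 0
    then show ?case by (auto intro!: poly_eqI)
  next
    case (Suc n)
    have "(X_dY ^^ n) (X_dY f) = 0" by (rule Suc.IH) (simp add: coeff_X_dY Suc.prems)
    then show ?case by (simp add: funpow_Suc_right del: funpow.simps)
  qed
  have "(X_dY ^^ Suc (degree f)) f = 0" by (rule *) (simp add: coeff_eq_0)
  then show ?thesis by blast
qed

lemma Y_dX_eq_0: "Y_dX f = 0 \<Longrightarrow> \<exists>c. coeff f j = [:c:]" for f :: "'a::field_char_0 poly poly"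
proof -
  assume "Y_dX f = 0"
  then have "pderiv (coeff f j) = 0" using coeff_Y_dX[of f "Suc j"] by simp
  then have "degree (coeff f j) = 0" by (simp add: pderiv_eq_0_iff)
  then show ?thesis by (metis degree_eq_zeroE)
qed

lemma X_dY_eq_0: "X_dY f = 0 \<Longrightarrow> \<exists>p. f = [:p:]" for f :: "'a::field_char_0 poly poly"
proof -
  assume "X_dY f = 0"
  then have "pderiv f = 0" by (simp add: X_dY_def)
  then have "degree f = 0" by (simp add: pderiv_eq_0_iff)
  then show ?thesis by (metis degree_eq_zeroE)
qed

text \<open>
  The assumption \<open>const_inverse\<close> makes the degree zero part of \<open>R\<close> a field, and \<open>fraction\<close> says that
  \<open>K\<close> lies in the fraction field of \<open>R\<close>.
\<close>

locale graded_coordinate_ring =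
  fixes k :: "'a::field_char_0 set" and R :: "'a poly set"
  assumes R: "is_subring R"
    and graded: "\<And>r i. r \<in> R \<Longrightarrow> monom (coeff r i) i \<in> R"
    and T: "monom 1 1 \<in> R"
    and finitely_generated: "\<exists>G. finite G \<and> R = is_subring hull ((\<lambda>c. [:c:]) ` k \<union> G)"
    and const_inverse: "\<And>c. [:c:] \<in> R \<Longrightarrow> [:inverse c:] \<in> R"
    and fraction: "\<And>c. \<exists>r\<in>R. r \<noteq> 0 \<and> smult c r \<in> R"
begin

abbreviation "Bp \<equiv> bihomogeneous R"

abbreviation B :: "'a ratfun2 set" where "B \<equiv> to_fract ` Bp"

lemma const_mem: "c \<in> k \<Longrightarrow> [:c:] \<in> R"
  using finitely_generated subset_subring_hull by fastforce

lemma Bp_subring: "is_subring Bp"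
  unfolding is_subring_def[of Bp]
proof (intro conjI ballI)
  show "1 \<in> Bp"
    unfolding bihomogeneous_def
  proof (intro CollectI allI)
    fix j show "monom 1 j * coeff 1 j \<in> R"
      using subring_one[OF R] subring_zero[OF R] by (cases j) (auto simp: monom_0 one_pCons)
  qed
  fix f g assume "f \<in> Bp" "g \<in> Bp"
  then have fg: "\<And>j. monom 1 j * coeff f j \<in> R" "\<And>j. monom 1 j * coeff g j \<in> R"
    by (auto simp: bihomogeneous_def)
  show "f - g \<in> Bp"
    using fg subring_diff[OF R] by (auto simp: bihomogeneous_def right_diff_distrib)
  have "monom 1 j * coeff (f * g) j = (\<Sum>i\<le>j. (monom 1 i * coeff f i) * (monom 1 (j - i) * coeff g (j - i)))" for j
    unfolding coeff_mult sum_distrib_left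
  proof (intro sum.cong refl)
    fix i assume "i \<in> {..j}"
    then have "(monom 1 j :: 'a poly) = monom 1 i * monom 1 (j - i)" by (simp add: mult_monom)
    then show "monom 1 j * (coeff f i * coeff g (j - i)) =
        (monom 1 i * coeff f i) * (monom 1 (j - i) * coeff g (j - i))" by (simp add: ac_simps)
  qed
  then show "f * g \<in> Bp"
    by (auto simp: bihomogeneous_def intro!: subring_sum[OF R] subring_mult[OF R fg(1) fg(2)])
qed

lemma B_subring: "is_subring B"
  by (rule to_fract.is_subring_image[OF Bp_subring])

lemma Bp_inner: "r \<in> R \<Longrightarrow> [:r:] \<in> Bp"
  using subring_zero[OF R] by (auto simp: bihomogeneous_def coeff_pCons monom_0 split: nat.split)

lemma Bp_monom: "monom (monom c i) j \<in> Bp" if "monom c (i + j) \<in> R"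
  using that subring_zero[OF R] by (auto simp: bihomogeneous_def mult_monom add.commute)

lemma Bp_coeff:
  assumes "f \<in> Bp"
  shows "monom (coeff (coeff f j) i) (i + j) \<in> R"
proof -
  have "monom (coeff (monom 1 j * coeff f j) (i + j)) (i + j) \<in> R"
    using assms by (intro graded) (auto simp: bihomogeneous_def)
  then show ?thesis by (simp add: coeff_monom_mult)
qed

text \<open>
  A generator \<open>c T\<^sup>m\<close> of \<open>R\<close> yields the generators \<open>c X\<^sup>i Y\<^sup>j\<close> with \<open>i + j = m\<close>. These suffice
  because a monomial of degree \<open>l + l'\<close> is a product of monomials of degrees \<open>l\<close> and \<open>l'\<close>.
\<close>

lemma B_affine: "affine_domain (ratfun2_const ` k) B"
proof -
  obtain G where G: "finite G" "R = is_subring hull ((\<lambda>c. [:c:]) ` k \<union> G)"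
    using finitely_generated by blast
  define W where "W = (\<Union>g\<in>G. (\<lambda>(i, j). monom (monom (coeff g (i + j)) i) j) ` ({..degree g} \<times> {..degree g}))"
  have finW: "finite W" unfolding W_def using G(1) by auto
  define k' where "k' = (\<lambda>c. [:[:c:]:]) ` k"
  define N where "N = is_subring hull (k' \<union> W)"
  have N: "is_subring N" unfolding N_def by (rule is_subring_hull)
  have kN: "k' \<subseteq> N" and WN: "W \<subseteq> N" unfolding N_def using subset_subring_hull by blast+
  have GR: "G \<subseteq> R" unfolding G(2) using subset_subring_hull by blast
  define Q where "Q = {r. \<forall>i j. monom (monom (coeff r (i + j)) i) j \<in> N}"
  have "is_subring Q"
    unfolding is_subring_def[of Q]
  proof (intro conjI ballI)
    have one: "[:[:1:]:] \<in> N" using subring_one[OF N] by (simp add: one_pCons)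
    show "1 \<in> Q"
      unfolding Q_def
    proof (intro CollectI allI)
      fix i j :: nat
      show "monom (monom (coeff 1 (i + j)) i) j \<in> N"
        using one subring_zero[OF N] by (simp add: monom_0 coeff_1)
    qed
    fix r s assume "r \<in> Q" "s \<in> Q"
    then have rs: "\<And>i j. monom (monom (coeff r (i + j)) i) j \<in> N" "\<And>i j. monom (monom (coeff s (i + j)) i) j \<in> N"
      by (auto simp: Q_def)
    show "r - s \<in> Q"
      using rs subring_diff[OF N] by (auto simp: Q_def simp flip: diff_monom)
    show "r * s \<in> Q"
      unfolding Q_def
    proof (intro CollectI allI)
      fix i j
      have "monom (monom (coeff r l * coeff s (i + j - l)) i) j \<in> N" if l: "l \<le> i + j" for l
      proof -
        (* X^i1 Y^j1 is a divisor of degree l of X^i Y^j. *)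
        define i1 where "i1 = min i l"
        define j1 where "j1 = l - i1"
        have le: "i1 \<le> i" "j1 \<le> j" and sum1: "i1 + j1 = l" and sum2: "(i - i1) + (j - j1) = i + j - l"
          using l by (auto simp: i1_def j1_def)
        have "monom (monom (coeff r l) i1) j1 * monom (monom (coeff s (i + j - l)) (i - i1)) (j - j1) \<in> N"
          using rs(1)[of i1 j1] rs(2)[of "i - i1" "j - j1"] unfolding sum1 sum2 by (rule subring_mult[OF N])
        then show ?thesis using le by (simp add: mult_monom)
      qed
      then have "(\<Sum>l\<le>i + j. monom (monom (coeff r l * coeff s (i + j - l)) i) j) \<in> N"
        by (intro subring_sum[OF N]) auto
      then show "monom (monom (coeff (r * s) (i + j)) i) j \<in> N"
        by (simp add: coeff_mult monom_sum)
    qed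
  qed
  moreover have "(\<lambda>c. [:c:]) ` k \<subseteq> Q"
  proof clarify
    fix c assume "c \<in> k"
    then have "[:[:c:]:] \<in> N" using kN by (auto simp: k'_def)
    then show "[:c:] \<in> Q"
      using subring_zero[OF N] by (auto simp: Q_def coeff_pCons monom_0 split: nat.split)
  qed
  moreover have "G \<subseteq> Q"
  proof
    fix g assume g: "g \<in> G"
    have "monom (monom (coeff g (i + j)) i) j \<in> N" for i j
    proof (cases "i + j \<le> degree g")
      case True
      then have "monom (monom (coeff g (i + j)) i) j \<in> W"
        unfolding W_def using g by (intro UN_I[of g] image_eqI[of _ _ "(i, j)"]) auto
      then show ?thesis using WN by auto
    next
      case False
      then show ?thesis using subring_zero[OF N] by (simp add: coeff_eq_0)
    qed
    then show "g \<in> Q" by (auto simp: Q_def)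
  qed
  ultimately have RQ: "R \<subseteq> Q" unfolding G(2) by (intro subring_hull_minimal) auto
  have BN: "Bp \<subseteq> N"
  proof
    fix f assume f: "f \<in> Bp"
    have "monom (monom (coeff (coeff f j) i) i) j \<in> N" for i j
    proof -
      have "monom (coeff (coeff f j) i) (i + j) \<in> Q" using RQ Bp_coeff[OF f] by blast
      then have "monom (monom (coeff (monom (coeff (coeff f j) i) (i + j)) (i + j)) i) j \<in> N"
        unfolding Q_def by blast
      then show ?thesis by simp
    qed
    then have "(\<Sum>j\<le>degree f. \<Sum>i\<le>degree (coeff f j). monom (monom (coeff (coeff f j) i) i) j) \<in> N"
      by (intro subring_sum[OF N])
    also have "(\<Sum>j\<le>degree f. \<Sum>i\<le>degree (coeff f j). monom (monom (coeff (coeff f j) i) i) j) = f"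
      by (simp add: poly_as_sum_of_monoms flip: monom_sum)
    finally show "f \<in> N" .
  qed
  have kB: "k' \<subseteq> Bp" using Bp_inner[OF const_mem] by (auto simp: k'_def)
  have "N \<subseteq> Bp"
    unfolding N_def
  proof (intro subring_hull_minimal Bp_subring Un_least kB)
    show "W \<subseteq> Bp" unfolding W_def using graded GR by (auto intro!: Bp_monom)
  qed
  with BN have "Bp = N" by auto
  then have "B = is_subring hull (to_fract ` k' \<union> to_fract ` W)"
    by (simp add: N_def to_fract.image_subring_hull image_Un)
  moreover have k'eq: "to_fract ` k' = ratfun2_const ` k"
    by (simp add: k'_def image_image ratfun2_const_eq)
  moreover have "ratfun2_const ` k \<subseteq> B" unfolding k'eq[symmetric] using kB by (rule image_mono)
  ultimately show ?thesis
    unfolding affine_domain_def using B_subring finW by auto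
qed

text \<open>
  For \<open>r = T\<^sup>j f\<^sub>j\<close> in \<open>R\<close>, the condition on \<open>Y \<partial>f/\<partial>X\<close> concerns \<open>T\<^bsup>j+1\<^esup> f\<^sub>j' = T r' - j r\<close>. A graded ring
  is closed under the Euler derivation \<open>r \<mapsto> T r'\<close>, which multiplies the component of degree \<open>l\<close>
  by \<open>l\<close>.
\<close>

lemma Y_dX_Bp: "f \<in> Bp \<Longrightarrow> Y_dX f \<in> Bp"
  unfolding bihomogeneous_def
proof (intro CollectI allI)
  fix j assume f: "f \<in> {f. \<forall>j. monom 1 j * coeff f j \<in> R}"
  show "monom 1 j * coeff (Y_dX f) j \<in> R"
  proof (cases j)
    case 0
    then show ?thesis by (simp add: coeff_Y_dX subring_zero[OF R])
  next
    case (Suc i)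
    define r where "r = monom 1 i * coeff f i"
    have r: "r \<in> R" using f by (simp add: r_def)
    have euler: "monom 1 1 * pderiv r = (\<Sum>l\<le>degree r. of_nat l * monom (coeff r l) l)"
    proof (rule poly_eqI)
      fix n
      have "coeff (\<Sum>l\<le>degree r. of_nat l * monom (coeff r l) l) n =
          (\<Sum>l\<le>degree r. if l = n then of_nat l * coeff r l else 0)"
        unfolding coeff_sum by (rule sum.cong) (auto simp: of_nat_poly)
      then have "coeff (\<Sum>l\<le>degree r. of_nat l * monom (coeff r l) l) n = of_nat n * coeff r n"
        by (auto simp: coeff_eq_0 not_le)
      moreover have "coeff (monom 1 1 * pderiv r) n = of_nat n * coeff r n"
        by (cases n) (auto simp: coeff_monom_mult coeff_pderiv)
      ultimately show "coeff (monom 1 1 * pderiv r) n =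
          coeff (\<Sum>l\<le>degree r. of_nat l * monom (coeff r l) l) n" by simp
    qed
    have eulerR: "monom 1 1 * pderiv r \<in> R"
      unfolding euler by (intro subring_sum[OF R] subring_mult[OF R] subring_of_nat[OF R] graded r)
    have "monom 1 1 * pderiv (monom 1 i :: 'a poly) = of_nat i * monom 1 i"
      by (cases i) (auto simp: pderiv_monom mult_monom of_nat_poly smult_monom simp flip: of_nat_Suc)
    then have "monom 1 1 * pderiv r = of_nat i * r + monom 1 1 * monom 1 i * pderiv (coeff f i)"
      by (simp add: r_def pderiv_mult algebra_simps)
    then have "monom 1 j * coeff (Y_dX f) j = monom 1 1 * pderiv r - of_nat i * r"
      by (simp add: Suc coeff_Y_dX mult_monom)
    then show ?thesis
      using eulerR r subring_of_nat[OF R] by (simp add: subring_diff[OF R] subring_mult[OF R])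
  qed
qed

lemma X_dY_Bp: "f \<in> Bp \<Longrightarrow> X_dY f \<in> Bp"
  unfolding bihomogeneous_def
proof (intro CollectI allI)
  fix j assume f: "f \<in> {f. \<forall>j. monom 1 j * coeff f j \<in> R}"
  have "monom 1 j * coeff (X_dY f) j = of_nat (Suc j) * (monom 1 j * monom 1 1 * coeff f (Suc j))"
    by (simp only: coeff_X_dY ac_simps)
  also have "monom 1 j * monom 1 1 = (monom 1 (Suc j) :: 'a poly)" by (simp add: mult_monom)
  finally show "monom 1 j * coeff (X_dY f) j \<in> R"
    using f subring_mult[OF R subring_of_nat[OF R]] by (simp only: mem_Collect_eq)
qed

definition D1 where "D1 = lift_to_fract Bp Y_dX"
definition D2 where "D2 = lift_to_fract Bp X_dY"

lemma D1: "D1 \<in> LND B"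
  unfolding D1_def by (intro lift_to_fract_LND Y_dX_Bp Y_dX_add Y_dX_mult Y_dX_nilpotent Bp_subring)

lemma D2: "D2 \<in> LND B"
  unfolding D2_def by (intro lift_to_fract_LND X_dY_Bp X_dY_add X_dY_mult X_dY_nilpotent Bp_subring)

lemma Makar_Limanov_B: "Makar_Limanov B = ratfun2_const ` {c. [:c:] \<in> R}"
proof (intro equalityI subsetI)
  fix x assume "x \<in> Makar_Limanov B"
  then have "x \<in> ker_on B D1" "x \<in> ker_on B D2" using D1 D2 by (auto simp: Makar_Limanov_def)
  then obtain f g where f: "f \<in> Bp" "Y_dX f = 0" "x = to_fract f" and g: "X_dY g = 0" "x = to_fract g"
    unfolding D1_def D2_def ker_lift_to_fract by blast
  have "f = g" using f(3) g(2) by simp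
  then obtain p where p: "f = [:p:]" using X_dY_eq_0 g(1) by blast
  obtain c where c: "p = [:c:]" using Y_dX_eq_0[OF f(2), of 0] p by auto
  have "[:c:] \<in> R" using f(1) unfolding p c bihomogeneous_def by (auto dest!: spec[of _ 0] simp: monom_0)
  then show "x \<in> ratfun2_const ` {c. [:c:] \<in> R}" using f(3) p c by (auto simp: ratfun2_const_eq)
next
  fix x assume "x \<in> ratfun2_const ` {c. [:c:] \<in> R}"
  then obtain c where c: "[:c:] \<in> R" "x = ratfun2_const c" by auto
  have mem: "ratfun2_const c \<in> B" if "[:c:] \<in> R" for c
    using Bp_inner[OF that] by (auto simp: ratfun2_const_eq)
  have "D x = 0" if D: "D \<in> LND B" for D
  proof (cases "c = 0")
    case True
    then have "x = 0" by (simp add: c ratfun2_const_eq)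
    then show ?thesis using derivation_on_zero[OF B_subring] D by (auto simp: LND_def)
  next
    case False
    have "inverse x = ratfun2_const (inverse c)"
      using False by (simp add: c ratfun2_const_def eq_fract one_pCons)
    then show ?thesis
      using LND_unit[OF B_subring D, of x] mem[OF c(1)] mem[OF const_inverse[OF c(1)]] c False
      by (auto simp: ratfun2_const_eq)
  qed
  then show "x \<in> Makar_Limanov B" using mem[OF c(1)] c(2) D1 by (auto simp: Makar_Limanov_def ker_on_def)
qed

text \<open>
  Comparing leading terms in \<open>c r = r'\<close> turns a representation of \<open>c\<close> as a fraction over \<open>R\<close> into a
  homogeneous one. Since \<open>e T\<^sup>m\<close> in \<open>R\<close> provides both \<open>e X\<^sup>m\<close> and \<open>e Y\<^sup>m\<close>, it makes \<open>c\<close> a fraction of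
  elements of either kernel.
\<close>

lemma homogeneous_fraction:
  fixes c :: 'a
  obtains m and e :: 'a where "e \<noteq> 0" "monom e m \<in> R" "monom (c * e) m \<in> R"
proof -
  obtain r where r: "r \<in> R" "r \<noteq> 0" "smult c r \<in> R" using fraction by blast
  define m where "m = degree r"
  show thesis
    by (rule that[of "coeff r m" m])
      (use r graded[OF r(1), of m] graded[OF r(3), of m] in \<open>auto simp: m_def\<close>)
qed

lemma Frac_kernels: "Frac (ker_on B D1) \<inter> Frac (ker_on B D2) = range ratfun2_const"
proof (intro equalityI subsetI)
  fix x :: "'a ratfun2" assume "x \<in> range ratfun2_const"
  then obtain c where c: "x = ratfun2_const c" by auto
  obtain m e where me: "e \<noteq> 0" "monom e m \<in> R" "monom (c * e) m \<in> R" using homogeneous_fraction by blast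
  have "x = to_fract (monom [:c * e:] m) / to_fract (monom [:e:] m)"
    using me(1) by (simp add: c ratfun2_const_def Fract_eq_divide[symmetric] eq_fract smult_monom
        flip: smult_monom_mult mult_monom)
  moreover have "monom [:b:] m \<in> {f \<in> Bp. Y_dX f = 0}" if "monom b m \<in> R" for b
    using Bp_monom[of b 0 m] that
    by (auto simp: monom_0 intro!: poly_eqI[of "Y_dX _"] simp: coeff_Y_dX split: nat.split)
  ultimately have 1: "x \<in> Frac (ker_on B D1)"
    unfolding Frac_def D1_def ker_lift_to_fract using me
    by (intro CollectI exI[of _ "to_fract (monom [:c * e:] m)"] exI[of _ "to_fract (monom [:e:] m)"]) auto
  have "x = to_fract [:monom (c * e) m:] / to_fract [:monom e m:]"
    using me(1) by (simp add: c ratfun2_const_def Fract_eq_divide[symmetric] eq_fract smult_monom)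
  moreover have "[:monom b m:] \<in> {f \<in> Bp. X_dY f = 0}" if "monom b m \<in> R" for b
    using Bp_inner[OF that] by (auto simp: X_dY_def pderiv_pCons)
  ultimately have "x \<in> Frac (ker_on B D2)"
    unfolding Frac_def D2_def ker_lift_to_fract using me
    by (intro CollectI exI[of _ "to_fract [:monom (c * e) m:]"] exI[of _ "to_fract [:monom e m:]"]) auto
  with 1 show "x \<in> Frac (ker_on B D1) \<inter> Frac (ker_on B D2)" by blast
next
  fix x assume x: "x \<in> Frac (ker_on B D1) \<inter> Frac (ker_on B D2)"
  then obtain a b where ab: "x = to_fract a / to_fract b" "Y_dX a = 0" "Y_dX b = 0" "b \<noteq> 0"
    unfolding Frac_def D1_def ker_lift_to_fract by auto
  obtain f g where fg: "x = to_fract f / to_fract g" "X_dY f = 0" "X_dY g = 0" "g \<noteq> 0"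
    using x unfolding Frac_def D2_def ker_lift_to_fract by auto
  obtain p q where pq: "f = [:p:]" "g = [:q:]" using X_dY_eq_0 fg by blast
  (* a and b are polynomials in Y, f and g in X; compare coefficients of Y^j in a g = f b. *)
  have "to_fract (a * g) = to_fract (f * b)" using ab fg by (simp add: field_simps)
  then have eq: "a * g = f * b" by (simp only: to_fract.eq_iff)
  obtain j where j: "coeff b j \<noteq> 0" using ab(4) by (metis leading_coeff_0_iff)
  obtain \<alpha> \<beta> where \<alpha>\<beta>: "coeff a j = [:\<alpha>:]" "coeff b j = [:\<beta>:]" using Y_dX_eq_0 ab(2,3) by metis
  have \<beta>: "\<beta> \<noteq> 0" using j \<alpha>\<beta> by auto
  have "smult \<alpha> q = smult \<beta> p"
    using arg_cong[OF eq, of "\<lambda>h. coeff h j"] by (simp add: pq \<alpha>\<beta> mult.commute)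
  then have "smult (inverse \<beta>) (smult \<alpha> q) = smult (inverse \<beta>) (smult \<beta> p)" by simp
  then have p: "p = smult (\<alpha> / \<beta>) q" using \<beta> by (simp add: field_simps)
  have "x = ratfun2_const (\<alpha> / \<beta>)"
    using fg(4) by (simp add: fg(1) pq p ratfun2_const_def Fract_eq_divide[symmetric] eq_fract)
  then show "x \<in> range ratfun2_const" by blast
qed

lemma B_subset_Frac: "B \<subseteq> Frac B"
  by (rule subset_Frac[OF B_subring])

lemma const_Frac: "range ratfun2_const \<subseteq> Frac B"
proof -
  have "Frac (ker_on B D1) \<subseteq> Frac B" by (rule Frac_mono) (auto simp: ker_on_def)
  then show ?thesis using Frac_kernels by blast
qed

lemma K_family_B: "range ratfun2_const \<in> K_family B"
proof -
  have "K_Delta B {D1, D2} = range ratfun2_const"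
    unfolding K_Delta_def using Frac_kernels const_Frac by auto
  then show ?thesis unfolding K_family_def using D1 D2 by blast
qed

lemma Frac_B: "Frac B = UNIV"
proof -
  have F: "is_subfield (Frac B)" by (rule is_subfield_Frac[OF B_subring])
  have Fr: "is_subring (Frac B)" by (rule subfield_subring[OF F])
  have cF: "to_fract [:[:c:]:] \<in> Frac B" for c using const_Frac by (auto simp: ratfun2_const_eq)
  have xF: "to_fract [:monom 1 1:] \<in> Frac B" using B_subset_Frac Bp_inner[OF T] by auto
  have yF: "to_fract (monom 1 1) \<in> Frac B"
    using B_subset_Frac Bp_monom[of 1 0 1] T by (auto simp: monom_0 one_pCons)
  have inner: "to_fract [:p:] \<in> Frac B" for p
  proof (induction p)
    case 0
    then show ?case using subring_zero[OF Fr] by simp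
  next
    case (pCons c p)
    have "[:pCons c p:] = [:[:c:]:] + [:monom 1 1:] * [:p:]" by (simp add: monom_Suc monom_0)
    then show ?case using cF[of c] xF pCons by (simp only: to_fract_add to_fract_mult) (intro subring_add[OF Fr] subring_mult[OF Fr])
  qed
  have all: "to_fract f \<in> Frac B" for f
  proof (induction f)
    case 0
    then show ?case using subring_zero[OF Fr] by simp
  next
    case (pCons p f)
    have "pCons p f = [:p:] + monom 1 1 * f" by (simp add: monom_Suc monom_0)
    then show ?case using inner[of p] yF pCons by (simp only: to_fract_add to_fract_mult) (intro subring_add[OF Fr] subring_mult[OF Fr])
  qed
  have "z \<in> Frac B" for z
    by (cases z) (auto simp: Fract_eq_divide intro!: subfield_divide[OF F] all)
  then show ?thesis by blast
qed

end

section \<open>Normality of the ring of bihomogeneous forms\<close>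

lemma not_integral_imp_transcendental:
  fixes E :: "'a::field set"
  assumes E: "is_subfield E" and s: "\<not> integral_over E s" and p: "p \<in> polys_over E" "poly p s = 0"
  shows "p = 0"
proof (rule ccontr)
  assume "p \<noteq> 0"
  then have lc: "lead_coeff p \<noteq> 0" by simp
  define q where "q = smult (inverse (lead_coeff p)) p"
  have "inverse (lead_coeff p) \<in> E" using p(1) E by (auto simp: polys_over_def is_subfield_def)
  then have "q \<in> polys_over E"
    using p(1) subring_mult[OF subfield_subring[OF E]] by (auto simp: polys_over_def q_def)
  moreover have "lead_coeff q = 1" "poly q s = 0" using lc p(2) by (simp_all add: q_def)
  ultimately show False using s unfolding integral_over_def by blast
qed

lemma normal_domain_adjoin_not_integral:
  fixes A :: "'a::field_char_0 set"
  assumes nA: "normal_domain A" and Q: "\<And>n. inverse (of_nat n) \<in> A"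
    and s: "\<not> integral_over (Frac A) s"
  shows "normal_domain (is_subring hull (insert s A))"
proof (rule normal_domain_adjoin_transcendental[OF nA Q])
  have "is_subfield (Frac A)" using nA by (intro is_subfield_Frac) (simp add: normal_domain_iff)
  then show "p = 0" if "p \<in> polys_over (Frac A)" "poly p s = 0" for p
    using not_integral_imp_transcendental s that by blast
qed

definition inner :: "'a::field poly \<Rightarrow> 'a ratfun2" where
  "inner p = to_fract [:p:]"

interpretation inner: inj_idom_hom "inner :: 'a::field poly \<Rightarrow> 'a ratfun2"
  by unfold_locales (simp_all add: inner_def one_pCons flip: to_fract_add to_fract_mult)

interpretation const: field_hom "ratfun2_const :: 'a::field \<Rightarrow> 'a ratfun2"
  by unfold_locales (simp_all add: ratfun2_const_eq one_pCons flip: to_fract_add to_fract_mult)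

definition xx :: "'a::field ratfun2" where "xx = inner (monom 1 1)"
definition yy :: "'a::field ratfun2" where "yy = to_fract (monom 1 1)"

lemma xx_neq_0 [simp]: "xx \<noteq> 0" by (simp add: xx_def)

lemma const_eq_inner: "ratfun2_const c = inner [:c:]"
  by (simp add: ratfun2_const_eq inner_def)

lemma poly_inner_yy: "poly (map_poly inner f) yy = to_fract f"
proof (induction f)
  case (pCons p f)
  have "pCons p f = [:p:] + monom 1 1 * f" by (simp add: monom_Suc monom_0)
  then have "to_fract (pCons p f) = inner p + yy * to_fract f"
    by (simp only: to_fract_add to_fract_mult inner_def yy_def)
  then show ?case using pCons by (simp add: map_poly_pCons)
qed simp

lemma poly_const_xx: "poly (map_poly ratfun2_const p) xx = inner p"
proof (induction p)
  case (pCons c p)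
  have "pCons c p = [:c:] + monom 1 1 * p" by (simp add: monom_Suc monom_0)
  then have "inner (pCons c p) = ratfun2_const c + xx * inner p"
    by (simp only: inner.hom_add inner.hom_mult const_eq_inner xx_def)
  then show ?case using pCons by (simp add: map_poly_pCons)
qed simp

lemma is_subring_UNIV: "is_subring UNIV"
  by (simp add: is_subring_def)

lemma is_subring_range_inner: "is_subring (range inner)"
  by (rule inner.is_subring_image[OF is_subring_UNIV])

lemma (in field_hom) is_subfield_image: "is_subfield F \<Longrightarrow> is_subfield (hom ` F)"
  unfolding is_subfield_def using is_subring_image by (auto simp: hom_inverse[symmetric] simp del: hom_inverse)

lemma not_integral_xx:
  fixes k :: "'a::field_char_0 set"
  shows "\<not> integral_over (range ratfun2_const) (xx :: 'a ratfun2)"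
proof
  have K: "is_subring (range ratfun2_const)" by (rule const.is_subring_image[OF is_subring_UNIV])
  assume "integral_over (range ratfun2_const) (xx :: 'a ratfun2)"
  then obtain n a where a: "\<And>i. i < n \<Longrightarrow> a i \<in> range (ratfun2_const :: 'a \<Rightarrow> _)" "xx ^ n + (\<Sum>i<n. a i * xx ^ i) = 0"
    unfolding integral_over_iff[OF K] by blast
  then have "\<exists>b. a i = ratfun2_const b" if "i < n" for i using that by auto
  then obtain b where b: "\<And>i. i < n \<Longrightarrow> a i = ratfun2_const (b i)" by metis
  have "inner (monom 1 n + (\<Sum>i<n. monom (b i) i)) = 0"
    using a(2) b
    by (simp add: xx_def const_eq_inner hom_distribs monom_power mult_monom flip: inner.hom_power)
      (simp add: smult_monom flip: inner.hom_mult)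
  then have "monom 1 n + (\<Sum>i<n. monom (b i) i) = 0" by simp
  then have "coeff (monom 1 n + (\<Sum>i<n. monom (b i) i)) n = 0" by simp
  then show False by (simp add: coeff_sum)
qed

text \<open>
  After clearing a denominator \<open>d\<close>, an integral equation of degree \<open>n\<close> for \<open>d y\<close> over \<open>K[x]\<close> would
  express \<open>d\<^sup>n y\<^sup>n\<close> by lower powers of \<open>y\<close>.
\<close>

lemma not_integral_yy: "\<not> integral_over (Frac (range inner)) (yy :: 'a::field_char_0 ratfun2)"
proof
  assume "integral_over (Frac (range inner)) (yy :: 'a ratfun2)"
  then obtain d where d: "d \<in> range (inner :: 'a poly \<Rightarrow> _)" "d \<noteq> 0" "integral_over (range inner) (d * yy)"
    using integral_clear_denominator[OF is_subring_range_inner] by blast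
  then obtain e :: "'a poly" where e: "d = inner e" "e \<noteq> 0" by auto
  obtain n a where a: "\<And>i. i < n \<Longrightarrow> a i \<in> range (inner :: 'a poly \<Rightarrow> _)" "(d * yy) ^ n + (\<Sum>i<n. a i * (d * yy) ^ i) = 0"
    using d(3) unfolding integral_over_iff[OF is_subring_range_inner] by blast
  then have "\<exists>b. a i = inner b" if "i < n" for i using that by auto
  then obtain b where b: "\<And>i. i < n \<Longrightarrow> a i = inner (b i)" by metis
  have pw: "(d * yy) ^ i = to_fract (monom (e ^ i) i)" for i
  proof -
    have "d * yy = to_fract (monom e 1)"
      by (simp add: e inner_def yy_def smult_monom flip: to_fract_mult)
    then show ?thesis by (simp add: monom_power to_fract.hom_power[symmetric] del: to_fract.hom_power)
  qed
  have "to_fract (monom (e ^ n) n + (\<Sum>i<n. monom (b i * e ^ i) i)) = (d * yy) ^ n + (\<Sum>i<n. a i * (d * yy) ^ i)"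
    unfolding pw by (simp add: hom_distribs b inner_def smult_monom flip: to_fract_mult)
  then have "monom (e ^ n) n + (\<Sum>i<n. monom (b i * e ^ i) i) = 0"
    using a(2) by (simp only: to_fract_eq_0_iff)
  then have "coeff (monom (e ^ n) n + (\<Sum>i<n. monom (b i * e ^ i) i)) n = 0" by simp
  then show False using e(2) by (simp add: coeff_sum)
qed

lemma normal_range_inner: "normal_domain (range (inner :: 'a::field_char_0 poly \<Rightarrow> _))"
proof -
  have K: "is_subfield (range (ratfun2_const :: 'a \<Rightarrow> _))"
    by (rule const.is_subfield_image) (simp add: is_subfield_def is_subring_def)
  have Kr: "is_subring (range (ratfun2_const :: 'a \<Rightarrow> _))" by (rule subfield_subring[OF K])
  have "normal_domain (is_subring hull (insert xx (range (ratfun2_const :: 'a \<Rightarrow> _))))"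
  proof (rule normal_domain_adjoin_not_integral)
    show "normal_domain (range (ratfun2_const :: 'a \<Rightarrow> _))" by (rule normal_domain_subfield[OF K])
    show "inverse (of_nat n) \<in> range (ratfun2_const :: 'a \<Rightarrow> _)" for n
      by (rule subfield_inverse[OF K subring_of_nat[OF Kr]])
    show "\<not> integral_over (Frac (range ratfun2_const)) (xx :: 'a ratfun2)"
      using not_integral_xx by (simp add: Frac_subfield[OF K])
  qed
  moreover have "is_subring hull (insert xx (range (ratfun2_const :: 'a \<Rightarrow> _))) = range inner"
  proof (intro equalityI)
    show "is_subring hull (insert xx (range (ratfun2_const :: 'a \<Rightarrow> _))) \<subseteq> range inner"
      by (intro subring_hull_minimal is_subring_range_inner) (auto simp: xx_def const_eq_inner)
    show "range inner \<subseteq> is_subring hull (insert xx (range (ratfun2_const :: 'a \<Rightarrow> _)))"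
      unfolding subring_hull_insert_eq[OF Kr] poly_const_xx[symmetric]
      by (auto simp: polys_over_def)
  qed
  ultimately show ?thesis by simp
qed

lemma inverse_of_nat_inner: "inverse (of_nat n) = inner [:inverse (of_nat n):]"
  by (simp add: const.hom_inverse const.hom_of_nat flip: const_eq_inner)

lemma normal_range_to_fract: "normal_domain (range (to_fract :: 'a::field_char_0 poly poly \<Rightarrow> _))"
proof -
  have "normal_domain (is_subring hull (insert yy (range (inner :: 'a poly \<Rightarrow> _))))"
    by (rule normal_domain_adjoin_not_integral[OF normal_range_inner _ not_integral_yy])
      (use inverse_of_nat_inner in blast)
  moreover have "is_subring hull (insert yy (range (inner :: 'a poly \<Rightarrow> _))) = range to_fract"
  proof (intro equalityI)
    show "is_subring hull (insert yy (range (inner :: 'a poly \<Rightarrow> _))) \<subseteq> range to_fract"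
      by (intro subring_hull_minimal to_fract.is_subring_image[OF is_subring_UNIV])
        (auto simp: yy_def inner_def)
    show "range to_fract \<subseteq> is_subring hull (insert yy (range (inner :: 'a poly \<Rightarrow> _)))"
      unfolding subring_hull_insert_eq[OF is_subring_range_inner] poly_inner_yy[symmetric]
      by (auto simp: polys_over_def)
  qed
  ultimately show ?thesis by simp
qed

lemma not_integral_ratio: "\<not> integral_over (Frac (range inner)) (yy / xx :: 'a::field_char_0 ratfun2)"
proof
  define E where "E = Frac (range (inner :: 'a poly \<Rightarrow> _))"
  have E: "is_subring E" unfolding E_def by (intro subfield_subring is_subfield_Frac is_subring_range_inner)
  have "xx \<in> E" unfolding E_def xx_def using subset_Frac[OF is_subring_range_inner] by blast
  assume "integral_over (Frac (range inner)) (yy / xx :: 'a ratfun2)"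
  then have "integral_over E (yy / xx * xx)"
    using subring_mult[OF is_subring_integral_closure[OF E], of "yy / xx" xx] integral_over_self[OF E \<open>xx \<in> E\<close>]
    by (simp add: E_def)
  then show False using not_integral_yy[where ?'a = 'a] by (simp add: E_def)
qed

text \<open>
  \<open>B\<close> is the intersection of the polynomial ring \<open>K[x, y]\<close> with the polynomial ring over \<open>R\<close> in
  the variable \<open>y / x\<close>; both are normal.
\<close>

lemma (in graded_coordinate_ring) B_normal:
  assumes nR: "normal_domain (inner ` R)"
  shows "normal_domain B"
  unfolding normal_domain_iff
proof (intro conjI ballI impI B_subring)
  define z :: "'a ratfun2" where "z = yy / xx"
  define A where "A = inner ` R"
  have A: "is_subring A" unfolding A_def by (rule inner.is_subring_image[OF R])
  have AE: "Frac A \<subseteq> Frac (range inner)" unfolding A_def by (rule Frac_mono) auto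
  have E: "is_subfield (Frac (range (inner :: 'a poly \<Rightarrow> _)))"
    by (rule is_subfield_Frac[OF is_subring_range_inner])
  have zE: "\<not> integral_over (Frac (range inner)) z" unfolding z_def by (rule not_integral_ratio)
  define S where "S = is_subring hull (insert z A)"
  have S: "S = {poly p z |p. p \<in> polys_over A}" unfolding S_def by (rule subring_hull_insert_eq[OF A])
  have nS: "normal_domain S"
    unfolding S_def
  proof (rule normal_domain_adjoin_not_integral)
    show "normal_domain A" using nR by (simp add: A_def)
    show "\<not> integral_over (Frac A) z" using zE integral_over_mono[OF AE] by blast
    show "inverse (of_nat n) \<in> A" for n
    proof -
      have "[:of_nat n:] \<in> R" using subring_of_nat[OF R, of n] by (simp add: of_nat_poly)
      then show ?thesis unfolding inverse_of_nat_inner A_def by (intro imageI const_inverse)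
    qed
  qed
  (* g written as a polynomial in z = y/x. *)
  define q where "q g = (\<Sum>j\<le>degree g. monom (inner (monom 1 j * coeff g j)) j)" for g :: "'a poly poly"
  have cq: "coeff (q g) j = inner (monom 1 j * coeff g j)" for g j
    by (auto simp: q_def coeff_sum coeff_eq_0 not_le)
  have pq: "poly (q g) z = to_fract g" for g
  proof -
    have "poly (q g) z = (\<Sum>j\<le>degree g. inner (monom 1 j * coeff g j) * z ^ j)"
      by (simp add: q_def poly_sum poly_monom)
    also have "\<dots> = (\<Sum>j\<le>degree g. inner (coeff g j) * yy ^ j)"
    proof (intro sum.cong refl)
      fix j
      have "inner (monom 1 j) = (xx :: 'a ratfun2) ^ j"
        by (simp add: xx_def monom_power flip: inner.hom_power)
      then show "inner (monom 1 j * coeff g j) * z ^ j = inner (coeff g j) * yy ^ j"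
        using xx_neq_0 by (simp add: z_def hom_distribs power_divide)
    qed
    also have "\<dots> = poly (map_poly inner g) yy" by (simp add: poly_altdef)
    finally show ?thesis by (simp add: poly_inner_yy)
  qed
  have BS: "B \<subseteq> S"
  proof clarify
    fix g assume "g \<in> Bp"
    then have "q g \<in> polys_over A" by (auto simp: polys_over_def cq bihomogeneous_def A_def)
    then show "to_fract g \<in> S" unfolding S pq[symmetric] by blast
  qed
  have BK: "B \<subseteq> range to_fract" by auto
  fix f assume f: "f \<in> Frac B" "integral_over B f"
  have "f \<in> S" using nS f Frac_mono[OF BS] integral_over_mono[OF BS] by (auto simp: normal_domain_iff)
  then obtain p where p: "p \<in> polys_over A" "f = poly p z" unfolding S by blast
  have "f \<in> range to_fract"
    using normal_range_to_fract f Frac_mono[OF BK] integral_over_mono[OF BK] unfolding normal_domain_iff by blast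
  then obtain g where g: "f = to_fract g" by blast
  have EF: "range inner \<subseteq> Frac (range (inner :: 'a poly \<Rightarrow> _))" by (rule subset_Frac[OF is_subring_range_inner])
  have "q g - p = 0"
  proof (rule not_integral_imp_transcendental[OF E zE])
    have "coeff (q g) j \<in> Frac (range inner)" "coeff p j \<in> Frac (range inner)" for j
      using EF p(1) unfolding cq polys_over_def A_def by blast+
    then show "q g - p \<in> polys_over (Frac (range inner))"
      using subring_diff[OF subfield_subring[OF E]] by (auto simp: polys_over_def)
    show "poly (q g - p) z = 0" using p(2) g by (simp add: pq)
  qed
  then have "coeff p j = inner (monom 1 j * coeff g j)" for j by (simp flip: cq)
  then have "inner (monom 1 j * coeff g j) \<in> inner ` R" for j using p(1) by (metis polys_overD A_def)
  then have "monom 1 j * coeff g j \<in> R" for j by (auto simp: inj_image_mem_iff[OF inner.inj_f])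
  then show "f \<in> B" unfolding g by (auto simp: bihomogeneous_def)
qed

section \<open>The coordinate ring generated in degree one\<close>

lemma field_generator_induct:
  assumes gen: "UNIV = is_subfield hull (k \<union> S)" and "k \<subseteq> F" "S \<subseteq> F" "is_subfield F"
  shows "F = UNIV"
  using hull_minimal[of "k \<union> S" F is_subfield] assms by auto

lemma graded_ring_generated_in_degree_one:
  fixes k :: "'a::field_char_0 set"
  assumes k: "is_subfield k" and S: "finite S" "UNIV = is_subfield hull (k \<union> S)"
  shows "\<exists>R. graded_coordinate_ring k R \<and> {c. [:c:] \<in> R} = k"
proof -
  define G :: "'a poly set" where "G = insert (monom 1 1) ((\<lambda>s. monom s 1) ` S)"
  define R where "R = is_subring hull ((\<lambda>c. [:c:]) ` k \<union> G)"
  have R: "is_subring R" unfolding R_def by (rule is_subring_hull)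
  have kR: "[:c:] \<in> R" if "c \<in> k" for c unfolding R_def by (rule hull_inc) (use that in auto)
  have TR: "monom 1 1 \<in> R" unfolding R_def by (rule hull_inc) (auto simp: G_def)
  have SR: "monom s 1 \<in> R" if "s \<in> S" for s unfolding R_def by (rule hull_inc) (use that in \<open>auto simp: G_def\<close>)
  have kr: "is_subring k" by (rule subfield_subring[OF k])
  have "is_subring {r. coeff r 0 \<in> k}"
    using kr by (auto simp: is_subring_def coeff_mult_0)
  then have "R \<subseteq> {r. coeff r 0 \<in> k}"
    unfolding R_def by (intro subring_hull_minimal) (auto simp: G_def subring_zero[OF kr])
  then have const: "[:c:] \<in> R \<longleftrightarrow> c \<in> k" for c using kR by force
  have "graded_coordinate_ring k R"
  proof
    show "is_subring R" "monom 1 1 \<in> R" by fact+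
    show "\<exists>G. finite G \<and> R = is_subring hull ((\<lambda>c. [:c:]) ` k \<union> G)"
      using S(1) R_def by (intro exI[of _ G]) (auto simp: G_def)
    show "[:inverse c:] \<in> R" if "[:c:] \<in> R" for c
      using that k unfolding const by (auto simp: is_subfield_def)
    have one: "[:1:] \<in> R" using subring_one[OF R] by (simp add: one_pCons)
    have "is_subring {r. \<forall>i. monom (coeff r i) i \<in> R}"
      unfolding is_subring_def[of "{r. \<forall>i. monom (coeff r i) i \<in> R}"]
    proof (intro conjI ballI)
      show "1 \<in> {r. \<forall>i. monom (coeff r i) i \<in> R}"
        using one subring_zero[OF R] by (auto simp: coeff_1 monom_0)
      fix r s assume "r \<in> {r. \<forall>i. monom (coeff r i) i \<in> R}" "s \<in> {r. \<forall>i. monom (coeff r i) i \<in> R}"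
      then have rs: "\<And>i. monom (coeff r i) i \<in> R" "\<And>i. monom (coeff s i) i \<in> R" by auto
      show "r - s \<in> {r. \<forall>i. monom (coeff r i) i \<in> R}"
        using rs subring_diff[OF R] by (auto simp flip: diff_monom)
      have "monom (coeff (r * s) n) n = (\<Sum>i\<le>n. monom (coeff r i) i * monom (coeff s (n - i)) (n - i))" for n
        by (simp add: coeff_mult monom_sum mult_monom)
      then show "r * s \<in> {r. \<forall>i. monom (coeff r i) i \<in> R}"
        using rs by (auto intro!: subring_sum[OF R] subring_mult[OF R])
    qed
    moreover have "(\<lambda>c. [:c:]) ` k \<union> G \<subseteq> {r. \<forall>i. monom (coeff r i) i \<in> R}"
      using kR TR SR subring_zero[OF R]
      by (auto simp: G_def coeff_pCons monom_0 split: nat.split)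
    ultimately have "R \<subseteq> {r. \<forall>i. monom (coeff r i) i \<in> R}"
      unfolding R_def by (intro subring_hull_minimal)
    then show "monom (coeff r i) i \<in> R" if "r \<in> R" for r i using that by blast
    define F where "F = {c. \<exists>r\<in>R. r \<noteq> 0 \<and> smult c r \<in> R}"
    have "is_subfield F"
      unfolding is_subfield_def is_subring_def[of F]
    proof (intro conjI ballI)
      show "1 \<in> F" unfolding F_def using one by (intro CollectI bexI[of _ "[:1:]"]) auto
      fix c d assume "c \<in> F" "d \<in> F"
      then obtain r s where rs: "r \<in> R" "r \<noteq> 0" "smult c r \<in> R" "s \<in> R" "s \<noteq> 0" "smult d s \<in> R"
        by (auto simp: F_def)
      have rs': "r * s \<in> R" "r * s \<noteq> 0" using rs subring_mult[OF R] by auto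
      have "smult (c - d) (r * s) = smult c r * s - r * smult d s"
        by (simp add: smult_diff_left)
      also have "\<dots> \<in> R" by (intro subring_diff[OF R] subring_mult[OF R] rs)
      finally show "c - d \<in> F" unfolding F_def using rs' by blast
      have "smult (c * d) (r * s) = smult c r * smult d s" by (simp add: mult.commute)
      also have "\<dots> \<in> R" by (intro subring_mult[OF R] rs)
      finally show "c * d \<in> F" unfolding F_def using rs' by blast
    next
      fix c assume "c \<in> F"
      then obtain r where r: "r \<in> R" "r \<noteq> 0" "smult c r \<in> R" by (auto simp: F_def)
      show "inverse c \<in> F"
      proof (cases "c = 0")
        case True
        then show ?thesis unfolding F_def using r subring_zero[OF R] by auto
      next
        case False
        then show ?thesis unfolding F_def using r by (intro CollectI bexI[of _ "smult c r"]) auto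
      qed
    qed
    moreover have "k \<subseteq> F"
      unfolding F_def using kR subring_one[OF R] by (auto intro!: bexI[of _ 1])
    moreover have "S \<subseteq> F"
      unfolding F_def using SR TR by (auto simp: smult_monom intro!: bexI[of _ "monom 1 1"])
    ultimately have "F = UNIV" by (intro field_generator_induct[OF S(2)])
    then show "\<exists>r\<in>R. r \<noteq> 0 \<and> smult c r \<in> R" for c unfolding F_def by blast
  qed
  then show ?thesis using const by auto
qed

section \<open>A normal coordinate ring\<close>

abbreviation (input) scale :: "nat \<Rightarrow> 'a::field poly \<Rightarrow> 'a poly" where
  "scale n p \<equiv> pcompose p [:0, of_nat n:]"

lemma scale_hom: "inj_idom_hom (\<lambda>p :: 'a::field_char_0 poly. scale n p)" if "0 < n"
proof
  show "pcompose p [:0, of_nat n:] = 0 \<Longrightarrow> p = 0" for p :: "'a poly"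
    using that by (simp add: pcompose_eq_0)
qed

lemma scale_comm_ring_hom: "comm_ring_hom (\<lambda>p :: 'a::field poly. scale n p)"
  by unfold_locales (simp_all add: pcompose_add pcompose_mult pcompose_1)

lemma coeff_0_hom: "comm_ring_hom (\<lambda>p :: 'a::comm_ring_1 poly. coeff p 0)"
  by unfold_locales (simp_all add: coeff_mult_0)

lemma coeff_scale: "coeff (scale n p) i = of_nat n ^ i * coeff p i"
proof (induction p arbitrary: i)
  case (pCons a p)
  then show ?case
    by (cases i) (simp_all add: pcompose_pCons coeff_pCons ac_simps)
qed simp

text \<open>
  The invariants of the construction of \<open>R\<close> inside \<open>K[x]\<close>. The condition on constant terms
  keeps the degree zero part algebraic over \<open>k\<close>. Stability under \<open>x \<mapsto> n x\<close> stands for being graded: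
  in contrast to the latter, it obviously passes to integral closures.
\<close>

definition admissible :: "'a::field_char_0 set \<Rightarrow> 'a ratfun2 set \<Rightarrow> bool" where
  "admissible k R \<longleftrightarrow>
     affine_domain (ratfun2_const ` k) R \<and> normal_domain R \<and> xx \<in> R \<and> R \<subseteq> range inner \<and>
     (\<forall>p. inner p \<in> R \<longrightarrow> integral_over k (coeff p 0)) \<and>
     (\<forall>p n. 0 < n \<longrightarrow> inner p \<in> R \<longrightarrow> inner (scale n p) \<in> R)"

lemma admissible_start:
  fixes k :: "'a::field_char_0 set"
  assumes k: "is_subfield k"
  shows "\<exists>R. admissible k R"
proof -
  define \<kappa> where "\<kappa> = ratfun2_const ` k"
  have \<kappa>: "is_subfield \<kappa>" unfolding \<kappa>_def by (rule const.is_subfield_image[OF k])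
  have \<kappa>r: "is_subring \<kappa>" by (rule subfield_subring[OF \<kappa>])
  have kr: "is_subring k" by (rule subfield_subring[OF k])
  define R where "R = is_subring hull (insert xx \<kappa>)"
  have R: "is_subring R" unfolding R_def by (rule is_subring_hull)
  have Req: "R = inner ` polys_over k"
  proof (intro equalityI)
    show "R \<subseteq> inner ` polys_over k"
      unfolding R_def
      by (intro subring_hull_minimal inner.is_subring_image is_subring_polys_over kr)
        (auto simp: \<kappa>_def xx_def const_eq_inner intro!: imageI polys_over_monom polys_over_const kr subring_one)
    show "inner ` polys_over k \<subseteq> R"
      unfolding R_def subring_hull_insert_eq[OF \<kappa>r] poly_const_xx[symmetric]
      by (auto simp: polys_over_def \<kappa>_def)
  qed
  have mem: "inner p \<in> R \<longleftrightarrow> p \<in> polys_over k" for p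
    unfolding Req by (rule inj_image_mem_iff[OF inner.inj_f])
  have "normal_domain R"
    unfolding R_def
  proof (rule normal_domain_adjoin_not_integral)
    show "normal_domain \<kappa>" by (rule normal_domain_subfield[OF \<kappa>])
    show "inverse (of_nat n) \<in> \<kappa>" for n by (rule subfield_inverse[OF \<kappa> subring_of_nat[OF \<kappa>r]])
    have "\<kappa> \<subseteq> range ratfun2_const" by (auto simp: \<kappa>_def)
    then show "\<not> integral_over (Frac \<kappa>) xx"
      using not_integral_xx integral_over_mono unfolding Frac_subfield[OF \<kappa>] by blast
  qed
  moreover have "affine_domain \<kappa> R"
    unfolding affine_domain_def
    using R subset_subring_hull[of "insert xx \<kappa>"] by (auto simp: R_def intro!: exI[of _ "{xx}"])
  moreover have "xx \<in> R" using subset_subring_hull[of "insert xx \<kappa>"] by (auto simp: R_def)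
  moreover have "integral_over k (coeff p 0)" if "inner p \<in> R" for p
    using that integral_over_self[OF kr] unfolding mem by (auto simp: polys_over_def)
  moreover have "inner (scale n p) \<in> R" if "inner p \<in> R" for n p
    using that subring_of_nat[OF kr] unfolding mem
    by (auto simp: polys_over_def coeff_scale intro!: subring_mult[OF kr] subring_power[OF kr])
  moreover have "R \<subseteq> range inner" unfolding Req by auto
  ultimately show ?thesis unfolding admissible_def \<kappa>_def by blast
qed

lemma admissible_subring: "admissible k R \<Longrightarrow> is_subring R"
  by (simp add: admissible_def normal_domain_iff)

text \<open>
  To enlarge the fraction field by a constant \<open>s\<close>, adjoin \<open>s x\<close> and, if \<open>s x\<close> is algebraic over
  the fraction field, pass to the integral closure. Integral equations are preserved by the
  specialisation \<open>x = 0\<close> and by the scalings \<open>x \<mapsto> n x\<close>.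
\<close>

lemma admissible_step:
  fixes k :: "'a::field_char_0 set"
  assumes k: "is_subfield k" and adm: "admissible k R"
  shows "\<exists>R'. admissible k R' \<and> R \<subseteq> R' \<and> ratfun2_const s \<in> Frac R'"
proof -
  define \<kappa> where "\<kappa> = ratfun2_const ` k"
  have \<kappa>: "is_subfield \<kappa>" unfolding \<kappa>_def by (rule const.is_subfield_image[OF k])
  have kr: "is_subring k" by (rule subfield_subring[OF k])
  have aR: "affine_domain \<kappa> R" and nR: "normal_domain R" and xR: "xx \<in> R" and Rin: "R \<subseteq> range inner"
    and R0: "\<And>p. inner p \<in> R \<Longrightarrow> integral_over k (coeff p 0)"
    and Rscale: "\<And>p n. 0 < n \<Longrightarrow> inner p \<in> R \<Longrightarrow> inner (scale n p) \<in> R"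
    using adm unfolding admissible_def \<kappa>_def by blast+
  have R: "is_subring R" by (rule admissible_subring[OF adm])
  define w where "w = inner (monom s 1)"
  have w: "w = ratfun2_const s * xx"
    by (simp add: w_def xx_def const_eq_inner smult_monom flip: inner.hom_mult)
  then have s: "ratfun2_const s = w / xx" using xx_neq_0 by simp
  define H where "H = is_subring hull (insert w R)"
  have H: "is_subring H" unfolding H_def by (rule is_subring_hull)
  have RH: "R \<subseteq> H" and wH: "w \<in> H" unfolding H_def using subset_subring_hull by blast+
  have Hin: "H \<subseteq> range inner"
    unfolding H_def using Rin by (intro subring_hull_minimal is_subring_range_inner) (auto simp: w_def)
  have Hscale: "inner (scale n p) \<in> H" if n: "0 < n" and p: "inner p \<in> H" for n p
  proof -
    interpret sc: inj_idom_hom "\<lambda>p :: 'a poly. scale n p" by (rule scale_hom[OF n])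
    define V where "V = inner ` {p. inner (scale n p) \<in> H}"
    have "is_subring {p. inner (scale n p) \<in> H}"
      unfolding is_subring_def using H by (auto simp: hom_distribs pcompose_1 pcompose_diff pcompose_mult
          intro!: subring_one subring_diff subring_mult)
    then have "is_subring V" unfolding V_def by (rule inner.is_subring_image)
    moreover have "w \<in> V"
    proof -
      have "scale n (monom s 1) = of_nat n * monom s 1"
        by (rule poly_eqI) (auto simp: coeff_scale of_nat_poly)
      then have "inner (scale n (monom s 1)) = of_nat n * w" by (simp add: w_def hom_distribs)
      also have "\<dots> \<in> H" by (intro subring_mult subring_of_nat H wH)
      finally show ?thesis unfolding V_def w_def by blast
    qed
    moreover have "R \<subseteq> V" unfolding V_def using Rin Rscale[OF n] RH by blast
    ultimately have "H \<subseteq> V" unfolding H_def by (intro subring_hull_minimal) auto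
    then show ?thesis using p by (auto simp: V_def)
  qed
  obtain G where G: "finite G" "R = is_subring hull (\<kappa> \<union> G)" and \<kappa>R: "\<kappa> \<subseteq> R"
    using aR by (auto simp: affine_domain_def)
  have QR: "inverse (of_nat n) \<in> R" for n
    using subfield_inverse[OF \<kappa> subring_of_nat[OF subfield_subring[OF \<kappa>]]] \<kappa>R by blast
  have IC: "is_subring {c. integral_over k c}" by (rule is_subring_integral_closure[OF kr])
  show ?thesis
  proof (cases "integral_over (Frac R) w")
    case False
    have "H = is_subring hull (\<kappa> \<union> insert w G)" unfolding H_def G(2) subring_hull_Un_insert by simp
    then have "affine_domain \<kappa> H" unfolding affine_domain_def using H RH \<kappa>R G(1) by blast
    moreover have "normal_domain H"
      unfolding H_def by (rule normal_domain_adjoin_not_integral[OF nR QR False])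
    moreover have "integral_over k (coeff p 0)" if "inner p \<in> H" for p
    proof -
      have "is_subring {p. integral_over k (coeff p 0)}"
        using IC unfolding is_subring_def by (simp add: coeff_mult_0)
      then have "is_subring (inner ` {p. integral_over k (coeff p 0)})"
        by (rule inner.is_subring_image)
      moreover have "R \<subseteq> inner ` {p. integral_over k (coeff p 0)}" using Rin R0 by blast
      moreover have "w \<in> inner ` {p. integral_over k (coeff p 0)}"
        unfolding w_def using subring_zero[OF IC] by (intro imageI) simp
      ultimately have "H \<subseteq> inner ` {p. integral_over k (coeff p 0)}"
        unfolding H_def by (intro subring_hull_minimal) auto
      then show ?thesis using that by auto
    qed
    ultimately have "admissible k H"
      unfolding admissible_def using xR RH Hin Hscale by (auto simp: \<kappa>_def)
    moreover have "ratfun2_const s \<in> Frac H"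
      unfolding s Frac_def using wH xR RH xx_neq_0 by blast
    ultimately show ?thesis using RH by blast
  next
    case True
    define C where "C = {c \<in> Frac H. integral_over R c}"
    have "affine_domain \<kappa> C" "normal_domain C"
      unfolding C_def H_def using affine_normal_integral_closure[OF \<kappa> aR nR True] by auto
    have RC: "R \<subseteq> C" unfolding C_def using RH subset_Frac[OF H] integral_over_self[OF R] by blast
    have Cin: "C \<subseteq> range inner"
      using normal_range_inner Frac_mono[OF Hin] integral_over_mono[OF Rin] unfolding C_def normal_domain_iff by blast
    define R' where "R' = {p. inner p \<in> R}"
    have RR': "R = inner ` R'" unfolding R'_def using Rin by blast
    have R': "is_subring R'"
      using R unfolding is_subring_def R'_def by (simp add: hom_distribs)
    have int: "integral_over R' p" if "inner p \<in> C" for p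
      using that inner.integral_over_image_iff[OF R'] unfolding C_def RR' by blast
    have C0: "integral_over k (coeff p 0)" if "inner p \<in> C" for p
    proof (rule integral_over_trans[OF kr])
      have "integral_over ((\<lambda>p. coeff p 0) ` R') (coeff p 0)"
        by (rule comm_ring_hom.integral_over_image[OF coeff_0_hom R' int[OF that]])
      then show "integral_over {x. integral_over k x} (coeff p 0)"
        by (rule integral_over_mono[rotated]) (auto simp: R'_def R0)
    qed
    have Cscale: "inner (scale n p) \<in> C" if n: "0 < n" and p: "inner p \<in> C" for n p
    proof -
      interpret sc: inj_idom_hom "\<lambda>p :: 'a poly. scale n p" by (rule scale_hom[OF n])
      have "integral_over ((\<lambda>p. scale n p) ` R') (scale n p)"
        by (rule comm_ring_hom.integral_over_image[OF scale_comm_ring_hom R' int[OF p]])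
      then have "integral_over R' (scale n p)"
        by (rule integral_over_mono[rotated]) (use Rscale[OF n] in \<open>auto simp: R'_def\<close>)
      then have 1: "integral_over R (inner (scale n p))"
        unfolding RR' inner.integral_over_image_iff[OF R'] .
      obtain a b where ab: "inner p = a / b" "a \<in> H" "b \<in> H" "b \<noteq> 0"
        using p unfolding C_def Frac_def by blast
      obtain u v where uv: "a = inner u" "b = inner v" using ab Hin by blast
      have "inner (p * v) = inner u" using ab uv by (simp add: hom_distribs field_simps)
      then have "p * v = u" by (simp only: inner.eq_iff)
      then have "scale n p * scale n v = scale n u" by (simp flip: pcompose_mult)
      then have "inner (scale n p) * inner (scale n v) = inner (scale n u)" by (simp flip: inner.hom_mult)
      moreover have v0: "inner (scale n v) \<noteq> 0" using ab(4) uv(2) by simp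
      ultimately have "inner (scale n p) = inner (scale n u) / inner (scale n v)"
        by (simp add: field_simps)
      then have "inner (scale n p) \<in> Frac H"
        unfolding Frac_def using Hscale[OF n] ab(2,3) v0 uv by blast
      then show ?thesis using 1 by (simp add: C_def)
    qed
    have "admissible k C"
      unfolding admissible_def
      using \<open>affine_domain \<kappa> C\<close> \<open>normal_domain C\<close> xR RC Cin C0 Cscale by (auto simp: \<kappa>_def)
    moreover have "ratfun2_const s \<in> Frac C"
    proof -
      obtain a where a: "a \<in> R" "a \<noteq> 0" "integral_over R (a * w)"
        using integral_clear_denominator[OF R True] by blast
      have "a * w \<in> H" using a(1) RH wH subring_mult[OF H] by blast
      then have "a * w \<in> C" using a(3) subset_Frac[OF H] by (auto simp: C_def)
      moreover have "a * xx \<in> C" using a(1) xR RC subring_mult[OF R] by blast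
      moreover have "ratfun2_const s = (a * w) / (a * xx)" "a * xx \<noteq> 0"
        using s a(2) xx_neq_0 by auto
      ultimately show ?thesis unfolding Frac_def by blast
    qed
    ultimately show ?thesis using RC by blast
  qed
qed

lemma admissible_exists:
  fixes k :: "'a::field_char_0 set"
  assumes k: "is_subfield k" and "finite S"
  shows "\<exists>R. admissible k R \<and> ratfun2_const ` S \<subseteq> Frac R"
  using assms(2)
proof (induction S rule: finite_induct)
  case empty
  then show ?case using admissible_start[OF k] by simp
next
  case (insert s S)
  then obtain R where R: "admissible k R" "ratfun2_const ` S \<subseteq> Frac R" by blast
  obtain R' where R': "admissible k R'" "R \<subseteq> R'" "ratfun2_const s \<in> Frac R'"
    using admissible_step[OF k R(1)] by blast
  then show ?case using R(2) Frac_mono[OF R'(2)] by (intro exI[of _ R']) auto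
qed

lemma algebraic_closure_in_eq:
  assumes k: "is_subfield k"
  shows "algebraic_closure_in k UNIV = {c. integral_over k c}"
proof (intro equalityI subsetI)
  fix c assume "c \<in> algebraic_closure_in k UNIV"
  then obtain p where "p \<noteq> 0" "p \<in> polys_over k" "poly p c = 0"
    by (auto simp: algebraic_closure_in_def polys_over_def)
  then show "c \<in> {c. integral_over k c}" using not_integral_imp_transcendental[OF k] by blast
next
  fix c assume "c \<in> {c. integral_over k c}"
  then obtain p where "lead_coeff p = 1" "p \<in> polys_over k" "poly p c = 0" by (auto simp: integral_over_def)
  then show "c \<in> algebraic_closure_in k UNIV"
    by (auto simp: algebraic_closure_in_def polys_over_def intro!: exI[of _ p])
qed

lemma normal_graded_ring:
  fixes k :: "'a::field_char_0 set"
  assumes k: "is_subfield k" and S: "finite S" "UNIV = is_subfield hull (k \<union> S)"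
  shows "\<exists>R. graded_coordinate_ring k R \<and> normal_domain (inner ` R) \<and>
    {c. [:c:] \<in> R} = algebraic_closure_in k UNIV"
proof -
  obtain Q where adm: "admissible k Q" and SQ: "ratfun2_const ` S \<subseteq> Frac Q"
    using admissible_exists[OF k S(1)] by blast
  define \<kappa> where "\<kappa> = ratfun2_const ` k"
  have kr: "is_subring k" by (rule subfield_subring[OF k])
  have aQ: "affine_domain \<kappa> Q" and nQ: "normal_domain Q" and xQ: "xx \<in> Q" and Qin: "Q \<subseteq> range inner"
    and Q0: "\<And>p. inner p \<in> Q \<Longrightarrow> integral_over k (coeff p 0)"
    and Qscale: "\<And>p n. 0 < n \<Longrightarrow> inner p \<in> Q \<Longrightarrow> inner (scale n p) \<in> Q"
    using adm unfolding admissible_def \<kappa>_def by blast+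
  have Q: "is_subring Q" by (rule admissible_subring[OF adm])
  have FQ: "is_subfield (Frac Q)" by (rule is_subfield_Frac[OF Q])
  obtain G where G: "finite G" "Q = is_subring hull (\<kappa> \<union> G)" and \<kappa>Q: "\<kappa> \<subseteq> Q"
    using aQ by (auto simp: affine_domain_def)
  define R where "R = {p. inner p \<in> Q}"
  have QR: "Q = inner ` R" unfolding R_def using Qin by blast
  have R: "is_subring R" using Q unfolding is_subring_def R_def by (simp add: hom_distribs)
  have "{c. ratfun2_const c \<in> Frac Q} = UNIV"
  proof (rule field_generator_induct[OF S(2)])
    show "k \<subseteq> {c. ratfun2_const c \<in> Frac Q}" using \<kappa>Q subset_Frac[OF Q] by (auto simp: \<kappa>_def)
    show "S \<subseteq> {c. ratfun2_const c \<in> Frac Q}" using SQ by auto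
    show "is_subfield {c. ratfun2_const c \<in> Frac Q}"
      using FQ unfolding is_subfield_def is_subring_def
      by (simp add: hom_distribs const.hom_inverse)
  qed
  then have constF: "ratfun2_const c \<in> Frac Q" for c by blast
  have const: "[:c:] \<in> R \<longleftrightarrow> integral_over k c" for c
  proof
    assume "[:c:] \<in> R"
    then show "integral_over k c" using Q0[of "[:c:]"] by (simp add: R_def)
  next
    assume "integral_over k c"
    then have "integral_over \<kappa> (ratfun2_const c)" unfolding \<kappa>_def by (rule const.integral_over_image[OF kr])
    then have "integral_over Q (ratfun2_const c)" by (rule integral_over_mono[OF \<kappa>Q])
    then show "[:c:] \<in> R" using nQ constF by (auto simp: normal_domain_iff R_def const_eq_inner)
  qed
  have inv: "[:inverse c:] \<in> R" if "[:c:] \<in> R" for c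
  proof -
    have c: "integral_over k c" using that const by blast
    have "inverse c \<in> is_subring hull (insert c k)"
      using is_subfield_adjoin_integral[OF k c] hull_inc[of c "insert c k" is_subring]
      by (auto simp: is_subfield_def)
    moreover have "is_subring hull (insert c k) \<subseteq> {c. integral_over k c}"
      using c integral_over_self[OF kr] by (intro subring_hull_minimal is_subring_integral_closure kr) auto
    ultimately show ?thesis unfolding const by blast
  qed
  have "graded_coordinate_ring k R"
  proof
    show "is_subring R" by (rule R)
    show "[:inverse c:] \<in> R" if "[:c:] \<in> R" for c by (rule inv[OF that])
    show "monom 1 1 \<in> R" using xQ by (simp add: R_def xx_def)
    show "monom (coeff r i) i \<in> R" if r: "r \<in> R" for r i
    proof -
      (* The values of g at positive integers n are the elements r(n x) of R. *)
      define g where "g = (\<Sum>i\<le>degree r. monom (monom (coeff r i) i) i)"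
      have cg: "coeff g i = monom (coeff r i) i" for i
        by (auto simp: g_def coeff_sum coeff_eq_0 not_le)
      have "coeff g i \<in> R"
      proof (rule coeff_mem_if_nat_values_mem)
        show "0 \<in> R" by (rule subring_zero[OF R])
        show "x - y \<in> R" if "x \<in> R" "y \<in> R" for x y by (rule subring_diff[OF R that])
        show "p \<in> R" if n: "0 < n" "of_nat n * p \<in> R" for n p
        proof -
          have "[:of_nat n:] \<in> R" using subring_of_nat[OF R, of n] by (simp add: of_nat_poly)
          then have "[:inverse (of_nat n):] * (of_nat n * p) \<in> R" by (intro subring_mult R inv n)
          then show ?thesis using n(1) by (simp add: of_nat_poly)
        qed
        show "poly g (of_nat n) \<in> R" if n: "0 < n" for n
        proof -
          have "poly g (of_nat n) = scale n r"
          proof (rule poly_eqI)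
            fix j
            have "poly g (of_nat n) = (\<Sum>i\<le>degree r. monom (of_nat n ^ i * coeff r i) i)"
              by (simp add: g_def poly_sum poly_monom of_nat_poly poly_const_pow smult_monom mult.commute)
            then show "coeff (poly g (of_nat n)) j = coeff (scale n r) j"
              by (auto simp: coeff_sum coeff_scale coeff_eq_0 not_le)
          qed
          then show ?thesis using Qscale[OF n] r by (simp add: R_def)
        qed
      qed
      then show ?thesis by (simp add: cg)
    qed
    show "\<exists>G. finite G \<and> R = is_subring hull ((\<lambda>c. [:c:]) ` k \<union> G)"
    proof -
      have "G \<subseteq> inner ` R" unfolding QR[symmetric] using G(2) subset_subring_hull by blast
      then obtain G' where G': "finite G'" "G = inner ` G'" using finite_subset_image[OF G(1)] by metis
      have "inner ` R = inner ` (is_subring hull ((\<lambda>c. [:c:]) ` k \<union> G'))"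
        unfolding inner.image_subring_hull QR[symmetric]
        by (simp add: G(2) G'(2) \<kappa>_def image_Un image_image const_eq_inner)
      then show ?thesis using G'(1) by (auto simp: inj_image_eq_iff[OF inner.inj_f])
    qed
    show "\<exists>r\<in>R. r \<noteq> 0 \<and> smult c r \<in> R" for c
    proof -
      obtain a b where ab: "ratfun2_const c = a / b" "a \<in> Q" "b \<in> Q" "b \<noteq> 0"
        using constF[of c] unfolding Frac_def by blast
      obtain u v where uv: "a = inner u" "b = inner v" "u \<in> R" "v \<in> R" using ab QR by blast
      have "inner [:c:] * inner v = inner u" using ab uv(1,2) by (simp add: const_eq_inner)
      then have "inner ([:c:] * v) = inner u" by (simp only: inner.hom_mult)
      then have "[:c:] * v = u" by (simp only: inner.eq_iff)
      then have "smult c v = u" by simp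
      then show ?thesis using uv ab(4) by (intro bexI[of _ v]) auto
    qed
  qed
  then show ?thesis
    using nQ const algebraic_closure_in_eq[OF k] unfolding QR by blast
qed

theorem proposition2p1:
  fixes k :: "'a::field_char_0 set"
  assumes "fg_field_extension k (UNIV :: 'a set)"
  shows
    "(\<exists>B :: 'a ratfun2 set.
        affine_domain (ratfun2_const ` k) B \<and>
        range ratfun2_const \<subseteq> Frac B \<and>
        Frac B = UNIV \<and>
        Makar_Limanov B = ratfun2_const ` k \<and>
        range ratfun2_const \<in> K_family B) \<and>
     (\<exists>B :: 'a ratfun2 set.
        affine_domain (ratfun2_const ` k) B \<and>
        normal_domain B \<and>
        range ratfun2_const \<subseteq> Frac B \<and>
        Frac B = UNIV \<and>
        Makar_Limanov B = ratfun2_const ` algebraic_closure_in k UNIV \<and>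
        range ratfun2_const \<in> K_family B)"
proof -
  have k: "is_subfield k" using assms by (simp add: fg_field_extension_def)
  obtain S where S: "finite S" "UNIV = is_subfield hull (k \<union> S)"
    using assms unfolding fg_field_extension_def by blast
  obtain R where R: "graded_coordinate_ring k R" "{c. [:c:] \<in> R} = k"
    using graded_ring_generated_in_degree_one[OF k S] by blast
  obtain R' where R': "graded_coordinate_ring k R'" "normal_domain (inner ` R')"
    "{c. [:c:] \<in> R'} = algebraic_closure_in k UNIV"
    using normal_graded_ring[OF k S] by blast
  interpret A: graded_coordinate_ring k R by (rule R(1))
  interpret N: graded_coordinate_ring k R' by (rule R'(1))
  show ?thesis
    using A.B_affine A.const_Frac A.Frac_B A.Makar_Limanov_B[unfolded R(2)] A.K_family_B
      N.B_affine N.B_normal[OF R'(2)] N.const_Frac N.Frac_B N.Makar_Limanov_B[unfolded R'(3)] N.K_family_B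
    by blast
qed

end
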